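(* Fix $p\in\mathbb{N}^*$. Then $$\limsup_{n\to\infty}\frac{\sup_{t\in\mathbb{R}}\big|\alpha_n^{(p)}(t)\big|}{\sqrt{\log\log n}}=\frac{(p+1/2)^{p+1/2}}{p!\,(p+1)^{p+1}}\quad\text{almost surely.}$$
   Context: $\mathbb{N}^*=\{1,2,\ldots\}$. $F$ is a continuous distribution function on $\mathbb{R}$ and $X_1,X_2,\ldots$ are i.i.d. with d.f. $F$. $\mathbb{F}_n(t)=\frac1n\sum_{i=1}^n\mathbf{1}_{\{X_i\le t\}}$. Define recursively $F^{(0)}=F$, $F^{(p)}(t)=\int_{(-\infty,t]}F^{(p-1)}(s)\,dF(s)$ and $\mathbb{F}_n^{(0)}=\mathbb{F}_n$, $\mathbb{F}_n^{(p)}(t)=\int_{(-\infty,t]}\mathbb{F}_n^{(p-1)}(s)\,d\mathbb{F}_n(s)$ for $p\ge1$. The $p$-fold integrated empirical process is $\alpha_n^{(p)}(t)=\sqrt n\,(\mathbb{F}_n^{(p)}(t)-F^{(p)}(t))$, $t\in\mathbb{R}$. *)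

theory Defs
  imports "HOL-Probability.Probability"
begin

text \<open>The integral is the Lebesgue--Stieltjes integral of the previous iterate against \<open>dG\<close> over
  \<open>(-\<infinity>, t]\<close>. The construction is the same for the true and for the empirical distribution
  function, so one recursion serves both. \<^const>\<open>interval_measure\<close> is the Stieltjes
  measure only for nondecreasing right-continuous \<open>G\<close>.\<close>

primrec iterated_df :: "(real \<Rightarrow> real) \<Rightarrow> nat \<Rightarrow> real \<Rightarrow> real" where
  "iterated_df G 0 = G"
| "iterated_df G (Suc p) = (\<lambda>t. LINT s:{..t}|interval_measure G. iterated_df G p s)"

definition empirical_df :: "(nat \<Rightarrow> 'a \<Rightarrow> real) \<Rightarrow> nat \<Rightarrow> 'a \<Rightarrow> real \<Rightarrow> real" where
  "empirical_df X n \<omega> t = (1 / real n) * (\<Sum>i=1..n. indicator {..t} (X i \<omega>))"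

definition integrated_empirical_process ::
  "(nat \<Rightarrow> 'a \<Rightarrow> real) \<Rightarrow> (real \<Rightarrow> real) \<Rightarrow> nat \<Rightarrow> nat \<Rightarrow> 'a \<Rightarrow> real \<Rightarrow> real" where
  "integrated_empirical_process X F p n \<omega> t =
     sqrt (real n) * (iterated_df (empirical_df X n \<omega>) p t - iterated_df F p t)"

end

theory Submission
  imports Defs "HOL-Real_Asymp.Real_Asymp"
begin

text \<open>For continuous \<open>F\<close> the variables \<open>U\<^sub>i = F (X\<^sub>i)\<close> are uniform on \<open>[0, 1]\<close>, and integrating powers of \<open>F\<close>
  against \<open>F\<close> gives \<open>iterated_df F p = F\<^sup>p\<^sup>+\<^sup>1 / (p + 1)!\<close>. Almost surely the sample has no ties. The iterated
  empirical function then depends only on the number \<open>N\<close> of sample points up to \<open>t\<close>: it is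
  \<open>(N + p choose p + 1) / n\<^sup>p\<^sup>+\<^sup>1\<close>, which is \<open>(N / n)\<^sup>p\<^sup>+\<^sup>1 / (p + 1)!\<close> up to \<open>O(1 / n)\<close>. Expanding the power to first order,
  the \<open>p\<close>-fold integrated process is \<open>F\<^sup>p / p!\<close> times the ordinary empirical process, up to an error
  of order \<open>ln (ln n) / sqrt n\<close> (\<open>integrated_empirical_process_approx\<close>).

  It remains to find the almost sure order of the supremum of the empirical process with weight \<open>F\<^sup>p\<close>. At a point with \<open>F t = u\<close>, the count
  is a sum of independent indicators of variance \<open>u (1 - u)\<close>, so the law of the iterated logarithm
  suggests the value \<open>u\<^sup>p sqrt (2 u (1 - u))\<close>. Its maximum over \<open>u\<close> is attained at
  \<open>u = (p + 1/2) / (p + 1)\<close> (\<open>weighted_sd_le\<close>, \<open>weighted_sd_max\<close>) and, divided by \<open>p!\<close>, is the constant of the theorem.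

  The upper bound needs the envelope \<open>sqrt (2 u (1 - u))\<close> uniformly in \<open>u\<close> (\<open>lil_upper_uniform\<close>). At finitely many points it
  follows from an exponential maximal inequality over geometric blocks and the Borel-Cantelli lemma (\<open>lil_upper_count\<close>).
  Between these points, two steps of chaining through finer grids with the same maximal inequality bound the oscillation (\<open>oscillation\<close>).

  The lower bound is needed only at one point \<open>t\<close> with \<open>F t = (p + 1/2) / (p + 1)\<close>, which exists by continuity
  (\<open>lil_lower_count\<close>). There the central limit theorem,
  applied to many equal subblocks of a long block, bounds from below the probability that the
  block sum is large, and the second Borel-Cantelli lemma makes this happen infinitely often.\<close>

section \<open>A maximal inequality for bounded independent summands\<close>

text \<open>The partial products of \<open>z\<close>, frozen at the first index where they reach the level \<open>a\<close>.
  Freezing turns a statement about the running maximum into one about a single final value.\<close>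

primrec stopped_product :: "real \<Rightarrow> (nat \<Rightarrow> real) \<Rightarrow> nat \<Rightarrow> real" where
  "stopped_product a z 0 = 1"
| "stopped_product a z (Suc n) =
     (if a \<le> stopped_product a z n then stopped_product a z n else stopped_product a z n * z (Suc n))"

lemma stopped_product_restrict:
  "n \<le> m \<Longrightarrow> stopped_product a (restrict z {1..m}) n = stopped_product a z n"
  by (induction n) auto

lemma stopped_product_nonneg: "(\<And>i. i \<ge> 1 \<Longrightarrow> 0 \<le> z i) \<Longrightarrow> 0 \<le> stopped_product a z n"
  by (induction n) auto

lemma stopped_product_hit:
  assumes "m \<le> n" "a \<le> (\<Prod>i=1..m. z i)"
  shows "a \<le> stopped_product a z n"
proof -
  have *: "stopped_product a z n = (\<Prod>i=1..n. z i) \<or> a \<le> stopped_product a z n" for n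
    by (induction n) (auto simp: prod.nat_ivl_Suc')
  have "a \<le> stopped_product a z m" using *[of m] assms(2) by auto
  with assms(1) show ?thesis
    by (induction n rule: dec_induct) auto
qed

lemma borel_measurable_stopped_product:
  "n \<le> m \<Longrightarrow> (\<lambda>z. stopped_product a z n) \<in> borel_measurable (PiM {1..m} (\<lambda>_. borel))"
proof (induction n)
  case (Suc n)
  then have [measurable]: "(\<lambda>z. stopped_product a z n) \<in> borel_measurable (PiM {1..m} (\<lambda>_. borel))"
    by simp
  have [measurable]: "(\<lambda>z. z (Suc n)) \<in> borel_measurable (PiM {1..m} (\<lambda>_. borel :: real measure))"
    using Suc.prems by (intro measurable_component_singleton) auto
  show ?case unfolding stopped_product.simps by measurable
qed simp

context prob_space
begin

text \<open>Working with the Lebesgue integral in \<^typ>\<open>ennreal\<close> spares every integrability side condition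
  in the supermartingale step below.\<close>

lemma indep_var_nn_integral_mult:
  fixes Y Z :: "'a \<Rightarrow> real"
  assumes "indep_var borel Y borel Z" "\<And>\<omega>. 0 \<le> Y \<omega>" "\<And>\<omega>. 0 \<le> Z \<omega>"
  shows "(\<integral>\<^sup>+\<omega>. ennreal (Y \<omega> * Z \<omega>) \<partial>M) = (\<integral>\<^sup>+\<omega>. ennreal (Y \<omega>) \<partial>M) * (\<integral>\<^sup>+\<omega>. ennreal (Z \<omega>) \<partial>M)"
proof -
  have "indep_var borel (ennreal \<circ> Y) borel (ennreal \<circ> Z)"
    by (rule indep_var_compose[OF assms(1)]) auto
  then have "indep_vars (\<lambda>_. borel) (case_bool (ennreal \<circ> Y) (ennreal \<circ> Z)) UNIV"
    unfolding indep_var_def by (rule indep_vars_cong[THEN iffD1, rotated 3]) (auto split: bool.split)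
  from indep_vars_nn_integral[OF _ this]
  show ?thesis using assms(2,3) by (simp add: UNIV_bool ennreal_mult mult.commute comp_def)
qed

text \<open>The frozen product is a supermartingale: before freezing, the next factor is independent of the past
  and has mean at most 1; after freezing, nothing changes.\<close>

lemma nn_integral_stopped_product_le:
  fixes Z :: "nat \<Rightarrow> 'a \<Rightarrow> real"
  assumes ind: "indep_vars (\<lambda>_. borel) Z {1..}" and pos: "\<And>i \<omega>. 0 \<le> Z i \<omega>"
    and mean: "\<And>i. i \<ge> 1 \<Longrightarrow> (\<integral>\<^sup>+\<omega>. ennreal (Z i \<omega>) \<partial>M) \<le> 1"
  shows "(\<integral>\<^sup>+\<omega>. ennreal (stopped_product a (\<lambda>i. Z i \<omega>) n) \<partial>M) \<le> 1"
proof (induction n)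
  case 0
  then show ?case by (simp add: emeasure_space_1)
next
  case (Suc n)
  let ?V = "\<lambda>n \<omega>. stopped_product a (\<lambda>i. Z i \<omega>) n"
  define W where "W \<omega> = (if a \<le> ?V n \<omega> then 0 else ?V n \<omega>)" for \<omega>
  define W' where "W' \<omega> = (if a \<le> ?V n \<omega> then ?V n \<omega> else 0)" for \<omega>
  have Z[measurable]: "Z i \<in> borel_measurable M" if "i \<ge> 1" for i
    using ind that by (auto simp: indep_vars_def)
  have Zrestr: "(\<lambda>\<omega>. restrict (\<lambda>i. Z i \<omega>) {1..n}) \<in> measurable M (PiM {1..n} (\<lambda>_. borel))"
    by (intro measurable_restrict Z) auto
  have V[measurable]: "?V n \<in> borel_measurable M"
    using measurable_compose[OF Zrestr borel_measurable_stopped_product[of n n a]]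
    by (simp del: One_nat_def add: stopped_product_restrict)
  have Vnn: "0 \<le> ?V n \<omega>" for \<omega> by (rule stopped_product_nonneg) (rule pos)
  have Wnn: "0 \<le> W \<omega>" "0 \<le> W' \<omega>" for \<omega> using Vnn by (auto simp: W_def W'_def)
  have [measurable]: "W \<in> borel_measurable M" "W' \<in> borel_measurable M"
    unfolding W_def W'_def by measurable
  have indW: "indep_var borel W borel (Z (Suc n))"
  proof -
    have "indep_var
      borel ((\<lambda>z. if a \<le> stopped_product a z n then 0 else stopped_product a z n) \<circ> (\<lambda>\<omega>. restrict (\<lambda>i. Z i \<omega>) {1..n}))
      borel ((\<lambda>f. f (Suc n)) \<circ> (\<lambda>\<omega>. restrict (\<lambda>i. Z i \<omega>) {Suc n}))"
      using borel_measurable_stopped_product[of n n a]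
      by (intro indep_var_compose[OF indep_var_restrict[OF ind]]) (auto intro!: measurable_component_singleton)
    then show ?thesis
      unfolding comp_def stopped_product_restrict[OF order_refl] W_def[abs_def] by simp
  qed
  have "(\<integral>\<^sup>+\<omega>. ennreal (?V (Suc n) \<omega>) \<partial>M) = (\<integral>\<^sup>+\<omega>. ennreal (W' \<omega>) + ennreal (W \<omega> * Z (Suc n) \<omega>) \<partial>M)"
    by (intro nn_integral_cong) (auto simp: W_def W'_def)
  also have "\<dots> = (\<integral>\<^sup>+\<omega>. ennreal (W' \<omega>) \<partial>M) + (\<integral>\<^sup>+\<omega>. ennreal (W \<omega> * Z (Suc n) \<omega>) \<partial>M)"
    by (rule nn_integral_add) auto
  also have "(\<integral>\<^sup>+\<omega>. ennreal (W \<omega> * Z (Suc n) \<omega>) \<partial>M) =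
      (\<integral>\<^sup>+\<omega>. ennreal (W \<omega>) \<partial>M) * (\<integral>\<^sup>+\<omega>. ennreal (Z (Suc n) \<omega>) \<partial>M)"
    by (rule indep_var_nn_integral_mult[OF indW Wnn(1) pos])
  also have "\<dots> \<le> (\<integral>\<^sup>+\<omega>. ennreal (W \<omega>) \<partial>M) * 1"
    by (intro mult_left_mono mean) auto
  also have "(\<integral>\<^sup>+\<omega>. ennreal (W' \<omega>) \<partial>M) + (\<integral>\<^sup>+\<omega>. ennreal (W \<omega>) \<partial>M) * 1 = (\<integral>\<^sup>+\<omega>. ennreal (W' \<omega>) + ennreal (W \<omega>) \<partial>M)"
    by (subst nn_integral_add) auto
  also have "\<dots> = (\<integral>\<^sup>+\<omega>. ennreal (?V n \<omega>) \<partial>M)"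
    by (intro nn_integral_cong) (auto simp: W_def W'_def)
  also have "\<dots> \<le> 1" by (rule Suc)
  finally show ?case by (simp add: add_left_mono)
qed

text \<open>Ville's inequality on a finite horizon: if some partial product reaches \<open>a\<close>, the frozen product is
  at least \<open>a\<close> at the end, so Markov's inequality for the end value bounds the running maximum.\<close>

lemma maximal_inequality_prod:
  fixes Z :: "nat \<Rightarrow> 'a \<Rightarrow> real"
  assumes ind: "indep_vars (\<lambda>_. borel) Z {1..}" and pos: "\<And>i \<omega>. 0 \<le> Z i \<omega>"
    and mean: "\<And>i. i \<ge> 1 \<Longrightarrow> (\<integral>\<^sup>+\<omega>. ennreal (Z i \<omega>) \<partial>M) \<le> 1" and "a > 0"
  shows "prob {\<omega> \<in> space M. \<exists>m\<le>n. a \<le> (\<Prod>i=1..m. Z i \<omega>)} \<le> 1 / a"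
proof -
  let ?V = "\<lambda>\<omega>. stopped_product a (\<lambda>i. Z i \<omega>) n"
  have Z: "Z i \<in> borel_measurable M" if "i \<ge> 1" for i
    using ind that by (auto simp: indep_vars_def)
  have Zrestr: "(\<lambda>\<omega>. restrict (\<lambda>i. Z i \<omega>) {1..n}) \<in> measurable M (PiM {1..n} (\<lambda>_. borel))"
    by (intro measurable_restrict Z) auto
  have V[measurable]: "?V \<in> borel_measurable M"
    using measurable_compose[OF Zrestr borel_measurable_stopped_product[of n n a]]
    by (simp del: One_nat_def add: stopped_product_restrict)
  have "prob {\<omega> \<in> space M. \<exists>m\<le>n. a \<le> (\<Prod>i=1..m. Z i \<omega>)} \<le> prob {\<omega> \<in> space M. a \<le> ?V \<omega>}"
    by (intro finite_measure_mono) (auto intro: stopped_product_hit)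
  also have "prob {\<omega> \<in> space M. a \<le> ?V \<omega>} \<le> 1/a"
  proof -
    have "emeasure M {\<omega> \<in> space M. a \<le> ?V \<omega>} = emeasure M {\<omega> \<in> space M. 1 \<le> ennreal (1/a) * ennreal (?V \<omega>)}"
      using \<open>a > 0\<close> stopped_product_nonneg[of "\<lambda>i. Z i _" a n, OF pos]
      by (intro arg_cong[where f="emeasure M"] Collect_cong)
         (auto simp flip: ennreal_mult' simp: field_simps)
    also have "\<dots> = emeasure M ({\<omega> \<in> space M. 1 \<le> ennreal (1/a) * ennreal (?V \<omega>)} \<inter> space M)"
      by (intro arg_cong[where f="emeasure M"]) auto
    also have "\<dots> \<le> ennreal (1/a) * (\<integral>\<^sup>+\<omega>. ennreal (?V \<omega>) * indicator (space M) \<omega> \<partial>M)"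
      using nn_integral_Markov_inequality[of "\<lambda>\<omega>. ennreal (?V \<omega>)" "space M" M "ennreal (1/a)"] by (simp add: Int_def conj_commute cong: conj_cong)
    also have "(\<integral>\<^sup>+\<omega>. ennreal (?V \<omega>) * indicator (space M) \<omega> \<partial>M) = (\<integral>\<^sup>+\<omega>. ennreal (?V \<omega>) \<partial>M)"
      by (intro nn_integral_cong) auto
    also have "\<dots> \<le> 1" by (rule nn_integral_stopped_product_le[OF ind pos mean])
    finally have "ennreal (prob {\<omega> \<in> space M. a \<le> ?V \<omega>}) \<le> ennreal (1/a)"
      by (simp add: emeasure_eq_measure mult_left_mono)
    then show ?thesis using \<open>a > 0\<close> by (subst (asm) ennreal_le_iff) auto
  qed
  finally show ?thesis .
qed

end

lemma exp_le_quadratic: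
  fixes x :: real
  shows "exp x \<le> 1 + x + x\<^sup>2 / 2 * exp \<bar>x\<bar>"
proof -
  obtain t where t: "\<bar>t\<bar> \<le> \<bar>x\<bar>" "exp x = (\<Sum>m<2. x ^ m / fact m) + exp t / fact 2 * x ^ 2"
    using Maclaurin_exp_le[of x 2] by auto
  have "exp t \<le> exp \<bar>x\<bar>" using t(1) by simp
  then have "exp t * x\<^sup>2 \<le> exp \<bar>x\<bar> * x\<^sup>2" by (intro mult_right_mono) auto
  with t(2) show ?thesis by (simp add: numeral_2_eq_2 field_simps)
qed

context prob_space
begin

text \<open>A Bernstein type bound. The factor \<open>exp \<bar>\<theta>\<bar>\<close> tends to 1 with \<open>\<theta>\<close>, so for small \<open>\<theta>\<close> the
  bound has the Gaussian exponent \<open>v \<theta>\<^sup>2 / 2\<close>; the sharp constant of the iterated logarithm law depends on this.\<close>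

lemma nn_integral_exp_le:
  fixes Y :: "'a \<Rightarrow> real"
  assumes [measurable]: "Y \<in> borel_measurable M" and bd: "\<And>\<omega>. \<bar>Y \<omega>\<bar> \<le> 1"
    and mean: "expectation Y = 0" and var: "expectation (\<lambda>\<omega>. (Y \<omega>)\<^sup>2) \<le> v"
  shows "(\<integral>\<^sup>+\<omega>. ennreal (exp (\<theta> * Y \<omega>)) \<partial>M) \<le> ennreal (exp (v * \<theta>\<^sup>2 * exp \<bar>\<theta>\<bar> / 2))"
proof -
  have int: "integrable M Y" "integrable M (\<lambda>\<omega>. (Y \<omega>)\<^sup>2)"
    using bd by (auto intro!: integrable_const_bound[where B=1] simp: abs_square_le_1)
  have Bound: "exp (\<theta> * Y \<omega>) \<le> 1 + \<theta> * Y \<omega> + \<theta>\<^sup>2 * exp \<bar>\<theta>\<bar> / 2 * (Y \<omega>)\<^sup>2" for \<omega>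
  proof -
    have "\<bar>\<theta> * Y \<omega>\<bar> \<le> \<bar>\<theta>\<bar>" using bd[of \<omega>] by (simp add: abs_mult mult_left_le)
    then have "(\<theta> * Y \<omega>)\<^sup>2 / 2 * exp \<bar>\<theta> * Y \<omega>\<bar> \<le> (\<theta> * Y \<omega>)\<^sup>2 / 2 * exp \<bar>\<theta>\<bar>"
      by (intro mult_left_mono) auto
    with exp_le_quadratic[of "\<theta> * Y \<omega>"] show ?thesis by (simp add: power_mult_distrib mult_ac)
  qed
  have "(\<integral>\<^sup>+\<omega>. ennreal (exp (\<theta> * Y \<omega>)) \<partial>M) \<le> (\<integral>\<^sup>+\<omega>. ennreal (1 + \<theta> * Y \<omega> + \<theta>\<^sup>2 * exp \<bar>\<theta>\<bar> / 2 * (Y \<omega>)\<^sup>2) \<partial>M)"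
    by (intro nn_integral_mono ennreal_leI Bound)
  also have "\<dots> = ennreal (\<integral>\<omega>. 1 + \<theta> * Y \<omega> + \<theta>\<^sup>2 * exp \<bar>\<theta>\<bar> / 2 * (Y \<omega>)\<^sup>2 \<partial>M)"
  proof (rule nn_integral_eq_integral)
    show "AE x in M. 0 \<le> 1 + \<theta> * Y x + \<theta>\<^sup>2 * exp \<bar>\<theta>\<bar> / 2 * (Y x)\<^sup>2"
      by (intro AE_I2 order.trans[OF _ Bound]) simp
  qed (use int in auto)
  also have "(\<integral>\<omega>. 1 + \<theta> * Y \<omega> + \<theta>\<^sup>2 * exp \<bar>\<theta>\<bar> / 2 * (Y \<omega>)\<^sup>2 \<partial>M) = 1 + \<theta>\<^sup>2 * exp \<bar>\<theta>\<bar> / 2 * expectation (\<lambda>\<omega>. (Y \<omega>)\<^sup>2)"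
    using int mean by (simp add: prob_space)
  also have "\<dots> \<le> 1 + v * \<theta>\<^sup>2 * exp \<bar>\<theta>\<bar> / 2"
    using mult_left_mono[OF var, of "\<theta>\<^sup>2 * exp \<bar>\<theta>\<bar> / 2"] by (simp add: mult_ac)
  also have "\<dots> \<le> exp (v * \<theta>\<^sup>2 * exp \<bar>\<theta>\<bar> / 2)" by (rule exp_ge_add_one_self)
  finally show ?thesis by (simp add: ennreal_leI)
qed

text \<open>The factors \<open>exp (\<theta> Y\<^sub>i - c)\<close> with \<open>c = v \<theta>\<^sup>2 exp \<bar>\<theta>\<bar> / 2\<close> have mean at most 1, so the
  maximal inequality for products applies. The horizon \<open>R\<close> is real because it will be a power of a real ratio.\<close>

lemma maximal_inequality_sum_one_sided:
  fixes Y :: "nat \<Rightarrow> 'a \<Rightarrow> real"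
  assumes ind: "indep_vars (\<lambda>_. borel) Y {1..}" and bd: "\<And>i \<omega>. \<bar>Y i \<omega>\<bar> \<le> 1"
    and mean: "\<And>i. i \<ge> 1 \<Longrightarrow> expectation (Y i) = 0"
    and var: "\<And>i. i \<ge> 1 \<Longrightarrow> expectation (\<lambda>\<omega>. (Y i \<omega>)\<^sup>2) \<le> v" and "v \<ge> 0"
  shows "prob {\<omega> \<in> space M. \<exists>n. real n \<le> R \<and> l \<le> \<theta> * (\<Sum>i=1..n. Y i \<omega>)} \<le>
    exp (R * v * \<theta>\<^sup>2 * exp \<bar>\<theta>\<bar> / 2 - l)"
proof (cases "R \<ge> 0")
  case True
  define c where "c = v * \<theta>\<^sup>2 * exp \<bar>\<theta>\<bar> / 2"
  have "c \<ge> 0" using \<open>v \<ge> 0\<close> by (simp add: c_def)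
  define Z where "Z i \<omega> = exp (\<theta> * Y i \<omega> - c)" for i \<omega>
  have [measurable]: "Y i \<in> borel_measurable M" if "i \<ge> 1" for i
    using ind that by (auto simp: indep_vars_def)
  have indZ: "indep_vars (\<lambda>_. borel) Z {1..}"
    unfolding Z_def[abs_def] by (rule indep_vars_compose2[OF ind]) auto
  have EZ: "(\<integral>\<^sup>+\<omega>. ennreal (Z i \<omega>) \<partial>M) \<le> 1" if "i \<ge> 1" for i
  proof -
    have "(\<integral>\<^sup>+\<omega>. ennreal (Z i \<omega>) \<partial>M) = (\<integral>\<^sup>+\<omega>. ennreal (exp (-c)) * ennreal (exp (\<theta> * Y i \<omega>)) \<partial>M)"
      unfolding Z_def by (intro nn_integral_cong) (simp flip: ennreal_mult' exp_add)
    also have "\<dots> = ennreal (exp (-c)) * (\<integral>\<^sup>+\<omega>. ennreal (exp (\<theta> * Y i \<omega>)) \<partial>M)"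
      using that by (intro nn_integral_cmult) auto
    also have "\<dots> \<le> ennreal (exp (-c)) * ennreal (exp c)"
      unfolding c_def using that by (intro mult_left_mono nn_integral_exp_le bd mean var) auto
    also have "\<dots> = 1" by (simp flip: ennreal_mult' exp_add)
    finally show ?thesis .
  qed
  define N where "N = nat \<lfloor>R\<rfloor>"
  have nN: "real n \<le> R \<longleftrightarrow> n \<le> N" for n unfolding N_def using True by (simp add: le_nat_iff le_floor_iff)
  have NR: "real N \<le> R" using nN by auto
  have prodZ: "(\<Prod>i=1..n. Z i \<omega>) = exp (\<theta> * (\<Sum>i=1..n. Y i \<omega>) - real n * c)" for n \<omega>
    unfolding Z_def by (simp flip: exp_sum add: sum_subtractf sum_distrib_left)
  define a where "a = exp (l - R * c)"
  have "prob {\<omega> \<in> space M. \<exists>n. real n \<le> R \<and> l \<le> \<theta> * (\<Sum>i=1..n. Y i \<omega>)} \<le>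
      prob {\<omega> \<in> space M. \<exists>n\<le>N. a \<le> (\<Prod>i=1..n. Z i \<omega>)}"
  proof (rule finite_measure_mono)
    have [measurable]: "Z i \<in> borel_measurable M" if "i \<ge> 1" for i
      using indZ that by (auto simp: indep_vars_def)
    have "(\<lambda>\<omega>. \<Prod>i=1..n. Z i \<omega>) \<in> borel_measurable M" for n
      by (intro borel_measurable_prod) auto
    then show "{\<omega> \<in> space M. \<exists>n\<le>N. a \<le> (\<Prod>i=1..n. Z i \<omega>)} \<in> events" by measurable
    have "a \<le> (\<Prod>i=1..n. Z i \<omega>)" if "real n \<le> R" "l \<le> \<theta> * (\<Sum>i=1..n. Y i \<omega>)" for n \<omega>
      using that mult_right_mono[OF that(1) \<open>c \<ge> 0\<close>] unfolding prodZ a_def by simp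
    then show "{\<omega> \<in> space M. \<exists>n. real n \<le> R \<and> l \<le> \<theta> * (\<Sum>i=1..n. Y i \<omega>)} \<subseteq> {\<omega> \<in> space M. \<exists>n\<le>N. a \<le> (\<Prod>i=1..n. Z i \<omega>)}"
      unfolding nN[symmetric] by blast
  qed
  also have "\<dots> \<le> 1 / a"
    by (rule maximal_inequality_prod[OF indZ _ EZ]) (auto simp: Z_def a_def)
  also have "\<dots> = exp (R * v * \<theta>\<^sup>2 * exp \<bar>\<theta>\<bar> / 2 - l)"
    by (simp add: a_def exp_diff c_def mult_ac)
  finally show ?thesis .
next
  case False
  then have "{\<omega> \<in> space M. \<exists>n. real n \<le> R \<and> l \<le> \<theta> * (\<Sum>i=1..n. Y i \<omega>)} = {}"
    by (auto dest: order.trans[OF of_nat_0_le_iff])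
  then show ?thesis by (simp only: measure_empty exp_ge_zero)
qed

text \<open>The choice \<open>\<theta> = b / (R v)\<close> minimises the Gaussian part of the exponent.\<close>

lemma maximal_inequality_sum:
  fixes Y :: "nat \<Rightarrow> 'a \<Rightarrow> real"
  assumes ind: "indep_vars (\<lambda>_. borel) Y {1..}" and bd: "\<And>i \<omega>. \<bar>Y i \<omega>\<bar> \<le> 1"
    and mean: "\<And>i. i \<ge> 1 \<Longrightarrow> expectation (Y i) = 0"
    and var: "\<And>i. i \<ge> 1 \<Longrightarrow> expectation (\<lambda>\<omega>. (Y i \<omega>)\<^sup>2) \<le> v"
    and "v > 0" "R > 0" "b > 0"
  shows "prob {\<omega> \<in> space M. \<exists>n. real n \<le> R \<and> b \<le> \<bar>\<Sum>i=1..n. Y i \<omega>\<bar>} \<le>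
    2 * exp (- (b\<^sup>2 / (R * v)) * (1 - exp (b / (R * v)) / 2))"
proof -
  define \<theta> where "\<theta> = b / (R * v)"
  have \<theta>: "\<theta> > 0" using assms by (simp add: \<theta>_def)
  have Y[measurable]: "Y i \<in> borel_measurable M" if "i \<ge> 1" for i
    using ind that by (auto simp: indep_vars_def)
  have S: "(\<lambda>\<omega>. \<Sum>i=1..n. Y i \<omega>) \<in> borel_measurable M" for n
    by (intro borel_measurable_sum Y) auto
  \<comment> \<open>\<open>s = 1\<close> is the upper tail, \<open>s = -1\<close> the lower tail\<close>
  let ?A = "\<lambda>s. {\<omega> \<in> space M. \<exists>n. real n \<le> R \<and> \<theta> * b \<le> (s * \<theta>) * (\<Sum>i=1..n. Y i \<omega>)}"
  have A: "?A s \<in> events" for s using S by measurable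
  have "prob {\<omega> \<in> space M. \<exists>n. real n \<le> R \<and> b \<le> \<bar>\<Sum>i=1..n. Y i \<omega>\<bar>} \<le> prob (?A 1 \<union> ?A (-1))"
  proof (rule finite_measure_mono)
    show "?A 1 \<union> ?A (-1) \<in> events" using A by blast
    have "\<theta> * b \<le> 1 * \<theta> * x \<or> \<theta> * b \<le> (-1) * \<theta> * x" if "b \<le> \<bar>x\<bar>" for x
      using \<theta> mult_left_mono[OF that, of \<theta>] by (cases "x \<ge> 0") auto
    then show "{\<omega> \<in> space M. \<exists>n. real n \<le> R \<and> b \<le> \<bar>\<Sum>i=1..n. Y i \<omega>\<bar>} \<subseteq> ?A 1 \<union> ?A (-1)" by blast
  qed
  also have "\<dots> \<le> prob (?A 1) + prob (?A (-1))" by (intro measure_Un_le A)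
  also have "\<dots> \<le> exp (R * v * (1*\<theta>)\<^sup>2 * exp \<bar>1*\<theta>\<bar> / 2 - \<theta> * b) + exp (R * v * ((-1)*\<theta>)\<^sup>2 * exp \<bar>(-1)*\<theta>\<bar> / 2 - \<theta> * b)"
    using \<open>v > 0\<close> by (intro add_mono maximal_inequality_sum_one_sided ind bd mean var) auto
  also have "\<dots> = 2 * exp (R * v * \<theta>\<^sup>2 * exp \<theta> / 2 - \<theta> * b)" using \<theta> by simp
  also have "R * v * \<theta>\<^sup>2 * exp \<theta> / 2 - \<theta> * b = - (b\<^sup>2 / (R * v)) * (1 - exp \<theta> / 2)"
    using assms by (simp add: \<theta>_def field_simps power2_eq_square)
  finally show ?thesis by (simp add: \<theta>_def)
qed

end

section \<open>The upper law of the iterated logarithm for counts\<close>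

text \<open>Reduces an almost sure statement about all large \<open>n\<close> to one event per block \<open>[\<rho>\<^sup>k, \<rho>\<^sup>k\<^sup>+\<^sup>1]\<close>, to which the
  Borel-Cantelli lemma applies.\<close>

lemma eventually_geometric_blocks:
  fixes \<rho> :: real
  assumes "\<rho> > 1"
    and ev: "eventually (\<lambda>k. \<forall>n. \<rho> ^ k \<le> real n \<and> real n \<le> \<rho> ^ (k + 1) \<longrightarrow> P n) sequentially"
  shows "eventually P sequentially"
proof -
  from ev obtain K where K: "\<And>k n. k \<ge> K \<Longrightarrow> \<rho> ^ k \<le> real n \<Longrightarrow> real n \<le> \<rho> ^ (k + 1) \<Longrightarrow> P n"
    unfolding eventually_sequentially by blast
  have "eventually (\<lambda>n. real n \<ge> \<rho> ^ K) sequentially"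
    using eventually_ge_at_top[of "nat \<lceil>\<rho> ^ K\<rceil>"] by eventually_elim linarith
  then show ?thesis
  proof eventually_elim
    case (elim n)
    have n: "real n \<ge> 1" using elim one_le_power[of \<rho> K] \<open>\<rho> > 1\<close> by linarith
    define k where "k = nat \<lfloor>log \<rho> (real n)\<rfloor>"
    have "log \<rho> (real n) \<ge> 0" using n \<open>\<rho> > 1\<close> by simp
    then have k: "real k \<le> log \<rho> (real n)" "log \<rho> (real n) \<le> real (k + 1)"
      unfolding k_def by linarith+
    have "real K \<le> log \<rho> (real n)" using elim n \<open>\<rho> > 1\<close> by (simp add: le_log_iff powr_realpow)
    then have "k \<ge> K" unfolding k_def by linarith
    moreover have "\<rho> ^ k \<le> real n" using k(1) n \<open>\<rho> > 1\<close> by (simp add: le_log_iff powr_realpow)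
    moreover have "real n \<le> \<rho> ^ (k + 1)"
      using k(2) n \<open>\<rho> > 1\<close> powr_realpow[of \<rho> "k + 1"] by (subst (asm) log_le_iff) auto
    ultimately show ?case by (rule K)
  qed
qed

context prob_space
begin

lemma borel_cantelli_eventually_le:
  assumes "\<And>k. A k \<in> events" and "eventually (\<lambda>k. prob (A k) \<le> f k) sequentially" and "summable f"
  shows "AE \<omega> in M. eventually (\<lambda>k. \<omega> \<notin> A k) sequentially"
proof -
  have "summable (\<lambda>k. prob (A k))"
    by (rule summable_comparison_test_ev[OF _ assms(3)]) (use assms(2) in simp)
  from borel_cantelli_AE1[OF assms(1) _ this]
  have "AE \<omega> in M. eventually (\<lambda>k. \<omega> \<in> space M - A k) sequentially"
    by (simp add: emeasure_eq_measure)
  then show ?thesis by eventually_elim (auto elim: eventually_mono)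
qed

lemma centred_indicator:
  fixes X :: "'a \<Rightarrow> real"
  assumes [measurable]: "X \<in> borel_measurable M" "B \<in> sets borel"
    and q: "prob {\<omega> \<in> space M. X \<omega> \<in> B} = q"
  shows "expectation (\<lambda>\<omega>. indicator B (X \<omega>) - q) = 0"
    and "expectation (\<lambda>\<omega>. (indicator B (X \<omega>) - q)\<^sup>2) = q * (1 - q)"
    and "\<bar>indicator B (X \<omega>) - q\<bar> \<le> 1"
proof -
  have q01: "0 \<le> q" "q \<le> 1" using q by auto
  have int: "integrable M (\<lambda>\<omega>. indicator B (X \<omega>) :: real)"
    by (rule integrable_const_bound[where B=1]) auto
  have E: "expectation (\<lambda>\<omega>. indicator B (X \<omega>)) = q"
  proof -
    have "expectation (\<lambda>\<omega>. indicator B (X \<omega>)) = expectation (indicator {\<omega> \<in> space M. X \<omega> \<in> B})"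
      by (intro Bochner_Integration.integral_cong) (auto simp: indicator_def)
    also have "\<dots> = prob ({\<omega> \<in> space M. X \<omega> \<in> B} \<inter> space M)" by (rule Bochner_Integration.integral_indicator)
    also have "{\<omega> \<in> space M. X \<omega> \<in> B} \<inter> space M = {\<omega> \<in> space M. X \<omega> \<in> B}" by auto
    finally show ?thesis using q by simp
  qed
  show "expectation (\<lambda>\<omega>. indicator B (X \<omega>) - q) = 0" using int E by (simp add: prob_space)
  have "(\<lambda>\<omega>. (indicator B (X \<omega>) - q)\<^sup>2) = (\<lambda>\<omega>. (1 - 2 * q) * indicator B (X \<omega>) + q\<^sup>2)"
    by (auto simp: indicator_def power2_eq_square algebra_simps)
  then show "expectation (\<lambda>\<omega>. (indicator B (X \<omega>) - q)\<^sup>2) = q * (1 - q)"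
    using int E by (simp add: prob_space power2_eq_square algebra_simps)
  show "\<bar>indicator B (X \<omega>) - q\<bar> \<le> 1" using q01 by (auto simp: indicator_def)
qed

lemma maximal_inequality_count:
  fixes X :: "nat \<Rightarrow> 'a \<Rightarrow> real"
  assumes ind: "indep_vars (\<lambda>_. borel) X {1..}" and B: "B \<in> sets borel"
    and q: "\<And>i. i \<ge> 1 \<Longrightarrow> prob {\<omega> \<in> space M. X i \<omega> \<in> B} = q"
    and "q * (1 - q) \<le> v" "v > 0" "R > 0" "b > 0"
  shows "prob {\<omega> \<in> space M. \<exists>n. real n \<le> R \<and> b \<le> \<bar>\<Sum>i=1..n. indicator B (X i \<omega>) - q\<bar>} \<le>
    2 * exp (- (b\<^sup>2 / (R * v)) * (1 - exp (b / (R * v)) / 2))"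
proof -
  have X: "X i \<in> borel_measurable M" if "i \<ge> 1" for i using ind that by (auto simp: indep_vars_def)
  have "\<bar>indicator B (X i \<omega>) - q\<bar> \<le> 1" for i \<omega>
  proof -
    have "0 \<le> q" "q \<le> 1" using q[of 1, symmetric] by auto
    then show ?thesis by (auto simp: indicator_def)
  qed
  moreover have "indep_vars (\<lambda>_. borel) (\<lambda>i \<omega>. indicator B (X i \<omega>) - q) {1..}"
    by (rule indep_vars_compose2[OF ind]) (use B in simp)
  ultimately show ?thesis
    using assms centred_indicator[OF X B q]
    by (intro maximal_inequality_sum) auto
qed

text \<open>Over the \<open>k\<close>-th block of ratio \<open>\<rho>\<close>, the maximal inequality bounds the probability of exceeding the
  target by about \<open>(k ln \<rho>) powr - \<kappa>\<close>. Any excess \<open>\<epsilon>\<close> over the sharp constant leaves room for a ratio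
  \<open>\<rho> > 1\<close> with \<open>\<kappa> > 1\<close>, and then these probabilities are summable. Half of \<open>\<epsilon>\<close> goes into the variance proxy
  \<open>v\<close>, which keeps \<open>v\<close> positive in the degenerate cases \<open>q = 0\<close> and \<open>q = 1\<close>.\<close>

lemma lil_upper_count:
  fixes X :: "nat \<Rightarrow> 'a \<Rightarrow> real"
  assumes ind: "indep_vars (\<lambda>_. borel) X {1..}" and B: "B \<in> sets borel"
    and q: "\<And>i. i \<ge> 1 \<Longrightarrow> prob {\<omega> \<in> space M. X i \<omega> \<in> B} = q" and "\<epsilon> > 0"
  shows "AE \<omega> in M. eventually (\<lambda>n. \<bar>\<Sum>i=1..n. indicator B (X i \<omega>) - q\<bar> \<le>
    (sqrt (2 * (q * (1 - q))) + \<epsilon>) * sqrt (real n * ln (ln (real n)))) sequentially"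
proof -
  have q01: "0 \<le> q" "q \<le> 1" using q[of 1, symmetric] by auto
  define s where "s = sqrt (2 * (q * (1 - q))) + \<epsilon> / 2"
  define c where "c = s + \<epsilon> / 2"
  have sqrt0: "sqrt (2 * (q * (1 - q))) \<ge> 0" using q01 by simp
  have s: "s > 0" "c > s" using sqrt0 \<open>\<epsilon> > 0\<close> unfolding s_def c_def by linarith+
  define v where "v = s\<^sup>2 / 2"
  have v: "v > 0" using s by (simp add: v_def)
  have "q * (1 - q) \<le> v"
  proof -
    have "2 * (q * (1 - q)) = (sqrt (2 * (q * (1 - q))))\<^sup>2" using q01 by simp
    also have "\<dots> \<le> s\<^sup>2" unfolding s_def using \<open>\<epsilon> > 0\<close> sqrt0 by (intro power_mono) linarith+
    finally show ?thesis by (simp add: v_def)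
  qed
  \<comment> \<open>the exponent is about \<open>(c / s)\<^sup>2 / \<rho>\<close> times \<open>l k\<close>; with \<open>\<rho> = c / s\<close> this is \<open>\<rho> > 1\<close>\<close>
  define \<rho> where "\<rho> = c / s"
  have \<rho>: "\<rho> > 1" using s by (simp add: \<rho>_def)
  \<comment> \<open>any number strictly between 1 and the limiting exponent \<open>\<rho>\<close>\<close>
  define \<kappa> where "\<kappa> = (1 + \<rho>) / 2"
  have \<kappa>: "\<kappa> > 1" using \<rho> by (simp add: \<kappa>_def)
  define R where "R k = \<rho> ^ (k + 1)" for k :: nat
  define l where "l k = ln (real k * ln \<rho>)" for k :: nat
  define b where "b k = c * sqrt (\<rho> ^ k * l k)" for k :: nat
  define A where "A k = {\<omega> \<in> space M. \<exists>n. real n \<le> R k \<and> b k \<le> \<bar>\<Sum>i=1..n. indicator B (X i \<omega>) - q\<bar>}" for k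
  have lnr: "ln \<rho> > 0" using \<rho> by simp
  have evl: "eventually (\<lambda>k. l k > 0) sequentially"
    unfolding l_def using lnr by real_asymp
  have "eventually (\<lambda>k. prob (A k) \<le> 2 * (real k * ln \<rho>) powr (- \<kappa>)) sequentially"
  proof -
    have "(\<lambda>k. 2 * \<rho> * (1 - exp (b k / (R k * v)) / 2)) \<longlonglongrightarrow> 2 * \<rho> * (1 - exp 0 / 2)"
    proof (intro tendsto_intros)
      show "(\<lambda>k. b k / (R k * v)) \<longlonglongrightarrow> 0"
        unfolding b_def R_def l_def using \<rho> lnr v s by real_asymp
    qed auto
    moreover have "2 * \<rho> * (1 - exp 0 / 2) > \<kappa>" using \<rho> by (simp add: \<kappa>_def)
    ultimately have "eventually (\<lambda>k. 2 * \<rho> * (1 - exp (b k / (R k * v)) / 2) > \<kappa>) sequentially"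
      by (rule order_tendstoD)
    with evl eventually_gt_at_top[of 0] show ?thesis
    proof eventually_elim
      case (elim k)
      have "prob (A k) \<le> 2 * exp (- ((b k)\<^sup>2 / (R k * v)) * (1 - exp (b k / (R k * v)) / 2))"
        unfolding A_def using elim s \<rho> v \<open>q * (1 - q) \<le> v\<close>
        by (intro maximal_inequality_count[OF ind B q]) (auto simp: b_def R_def)
      also have "(b k)\<^sup>2 / (R k * v) = 2 * \<rho> * l k"
        using elim s \<rho> unfolding b_def R_def v_def
        by (simp add: power_mult_distrib field_simps power2_eq_square \<rho>_def)
      also have "- (2 * \<rho> * l k) * (1 - exp (b k / (R k * v)) / 2) \<le> - \<kappa> * l k"
        using mult_right_mono[of \<kappa> "2 * \<rho> * (1 - exp (b k / (R k * v)) / 2)" "l k"] elim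
        by (simp add: mult_ac)
      also have "exp (- \<kappa> * l k) = (real k * ln \<rho>) powr (- \<kappa>)"
        using elim lnr by (simp add: powr_def l_def)
      finally show ?case by simp
    qed
  qed
  moreover have "summable (\<lambda>k. 2 * (real k * ln \<rho>) powr (- \<kappa>))"
  proof -
    have "summable (\<lambda>k. real k powr (- \<kappa>))" using \<kappa> by (subst summable_real_powr_iff) auto
    from summable_mult[OF this, of "2 * ln \<rho> powr (-\<kappa>)"] show ?thesis
      using lnr by (simp add: powr_mult mult_ac)
  qed
  moreover have "A k \<in> events" for k
  proof -
    have X: "X i \<in> borel_measurable M" if "i \<ge> 1" for i using ind that by (auto simp: indep_vars_def)
    have "(\<lambda>\<omega>. \<Sum>i=1..n. indicator B (X i \<omega>) - q) \<in> borel_measurable M" for n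
      using B by (intro borel_measurable_sum borel_measurable_diff borel_measurable_const
        measurable_compose[OF X borel_measurable_indicator]) auto
    then show ?thesis unfolding A_def by measurable
  qed
  ultimately have "AE \<omega> in M. eventually (\<lambda>k. \<omega> \<notin> A k) sequentially"
    by (rule borel_cantelli_eventually_le[rotated 1])
  then show ?thesis
    using AE_space
  proof eventually_elim
    case (elim \<omega>)
    show ?case
    proof (rule eventually_geometric_blocks[OF \<rho>])
      show "eventually (\<lambda>k. \<forall>n. \<rho> ^ k \<le> real n \<and> real n \<le> \<rho> ^ (k + 1) \<longrightarrow> \<bar>\<Sum>i=1..n. indicator B (X i \<omega>) - q\<bar> \<le>
        (sqrt (2 * (q * (1 - q))) + \<epsilon>) * sqrt (real n * ln (ln (real n)))) sequentially"
        using elim(1) evl eventually_gt_at_top[of 0]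
      proof (eventually_elim, intro allI impI)
        fix k n assume k: "\<omega> \<notin> A k" "l k > 0" "k > 0" and n: "\<rho> ^ k \<le> real n \<and> real n \<le> \<rho> ^ (k + 1)"
        have "\<bar>\<Sum>i=1..n. indicator B (X i \<omega>) - q\<bar> \<le> b k"
          using k(1) elim(2) n unfolding A_def R_def by force
        also have "b k \<le> c * sqrt (real n * ln (ln (real n)))"
        proof -
          have "\<rho> ^ k > 0" using \<rho> by simp
          have "real k * ln \<rho> = ln (\<rho> ^ k)" using \<rho> by (simp add: ln_realpow)
          also have "\<dots> \<le> ln (real n)" using n \<open>\<rho> ^ k > 0\<close> by (subst ln_le_cancel_iff) linarith+
          finally have "l k \<le> ln (ln (real n))" using k lnr unfolding l_def
            by (subst ln_le_cancel_iff) (auto intro: less_le_trans[rotated])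
          then show ?thesis unfolding b_def using n k s \<rho>
            by (intro mult_left_mono real_sqrt_le_mono mult_mono) auto
        qed
        also have "c = sqrt (2 * (q * (1 - q))) + \<epsilon>" by (simp add: c_def s_def)
        finally show "\<bar>\<Sum>i=1..n. indicator B (X i \<omega>) - q\<bar> \<le>
          (sqrt (2 * (q * (1 - q))) + \<epsilon>) * sqrt (real n * ln (ln (real n)))" .
      qed
    qed
  qed
qed

end

section \<open>The upper law uniformly over the uniform empirical process\<close>

text \<open>The model for the transformed sample \<open>U\<^sub>i = F (X\<^sub>i)\<close>, to which the case of a general continuous \<open>F\<close> reduces.\<close>

locale uniform_sample = prob_space M for M :: "'a measure" +
  fixes U :: "nat \<Rightarrow> 'a \<Rightarrow> real"
  assumes indep_U: "indep_vars (\<lambda>_. borel) U {1..}"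
    and uniform_U: "\<And>i q. i \<ge> 1 \<Longrightarrow> 0 \<le> q \<Longrightarrow> q \<le> 1 \<Longrightarrow> prob {\<omega> \<in> space M. U i \<omega> \<le> q} = q"
begin

definition centred_count :: "nat \<Rightarrow> real \<Rightarrow> 'a \<Rightarrow> real" where
  "centred_count n u \<omega> = (\<Sum>i=1..n. indicator {..u} (U i \<omega>) - u)"

lemma measurable_U [measurable]: "i \<ge> 1 \<Longrightarrow> U i \<in> borel_measurable M"
  using indep_U by (auto simp: indep_vars_def)

lemma measurable_centred_count [measurable]: "centred_count n u \<in> borel_measurable M"
proof -
  have "(\<lambda>\<omega>. \<Sum>i=1..n. indicator {..u} (U i \<omega>) - u) \<in> borel_measurable M"
    by (intro borel_measurable_sum borel_measurable_diff borel_measurable_const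
        measurable_compose[OF measurable_U borel_measurable_indicator]) auto
  then show ?thesis by (simp add: centred_count_def[abs_def])
qed

lemma prob_interval:
  assumes "i \<ge> 1" "0 \<le> a" "a \<le> b" "b \<le> 1"
  shows "prob {\<omega> \<in> space M. U i \<omega> \<in> {a<..b}} = b - a"
proof -
  have [measurable]: "U i \<in> borel_measurable M" using assms by simp
  have "prob {\<omega> \<in> space M. U i \<omega> \<le> b} = prob ({\<omega> \<in> space M. U i \<omega> \<le> a} \<union> {\<omega> \<in> space M. U i \<omega> \<in> {a<..b}})"
    using assms by (intro arg_cong[where f=prob]) auto
  also have "\<dots> = prob {\<omega> \<in> space M. U i \<omega> \<le> a} + prob {\<omega> \<in> space M. U i \<omega> \<in> {a<..b}}"
    by (intro finite_measure_Union) auto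
  finally show ?thesis using assms by (simp add: uniform_U)
qed

lemma centred_count_diff:
  assumes "a \<le> b"
  shows "centred_count n b \<omega> - centred_count n a \<omega> = (\<Sum>i=1..n. indicator {a<..b} (U i \<omega>) - (b - a))"
  unfolding centred_count_def sum_subtractf[symmetric] using assms
  by (intro sum.cong) (auto simp: indicator_def)

text \<open>A union bound over finitely many increments of length at most \<open>v\<close>. In the range \<open>b \<le> R v / 4\<close> the
  Bernstein correction \<open>exp (b / (R v)) / 2\<close> is at most \<open>2/3\<close>, which leaves a plain Gaussian tail.\<close>

lemma maximal_inequality_increments:
  fixes \<alpha> \<beta> :: "'i \<Rightarrow> real"
  assumes "finite J" and ab: "\<And>j. j \<in> J \<Longrightarrow> 0 \<le> \<alpha> j \<and> \<alpha> j \<le> \<beta> j \<and> \<beta> j \<le> 1 \<and> \<beta> j - \<alpha> j \<le> v"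
    and pos: "v > 0" "R > 0" "b > 0" and "b \<le> R * v / 4"
  shows "prob {\<omega> \<in> space M. \<exists>n. real n \<le> R \<and> (\<exists>j\<in>J. b \<le> \<bar>centred_count n (\<beta> j) \<omega> - centred_count n (\<alpha> j) \<omega>\<bar>)} \<le>
    real (card J) * (2 * exp (- (b\<^sup>2 / (3 * R * v))))"
proof -
  let ?A = "\<lambda>j. {\<omega> \<in> space M. \<exists>n. real n \<le> R \<and> b \<le> \<bar>centred_count n (\<beta> j) \<omega> - centred_count n (\<alpha> j) \<omega>\<bar>}"
  have "{\<omega> \<in> space M. \<exists>n. real n \<le> R \<and> (\<exists>j\<in>J. b \<le> \<bar>centred_count n (\<beta> j) \<omega> - centred_count n (\<alpha> j) \<omega>\<bar>)} = (\<Union>j\<in>J. ?A j)"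
    by blast
  also have "prob \<dots> \<le> (\<Sum>j\<in>J. prob (?A j))"
    using \<open>finite J\<close> by (intro finite_measure_subadditive_finite) auto
  also have "\<dots> \<le> (\<Sum>j\<in>J. 2 * exp (- (b\<^sup>2 / (3 * R * v))))"
  proof (rule sum_mono)
    fix j assume "j \<in> J"
    note ab = ab[OF this]
    define q where "q = \<beta> j - \<alpha> j"
    have "q * (1 - q) \<le> q * 1" unfolding q_def using ab by (intro mult_left_mono) auto
    then have qv: "q * (1 - q) \<le> v" using ab by (simp add: q_def)
    have "prob (?A j) \<le> 2 * exp (- (b\<^sup>2 / (R * v)) * (1 - exp (b / (R * v)) / 2))"
      using ab pos qv unfolding centred_count_diff[OF conjunct1[OF conjunct2[OF ab]]] q_def
      by (intro maximal_inequality_count[OF indep_U] prob_interval) auto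
    also have "- (b\<^sup>2 / (R * v)) * (1 - exp (b / (R * v)) / 2) \<le> - (b\<^sup>2 / (R * v)) * (1/3)"
    proof (intro mult_left_mono_neg)
      have "b / (R * v) \<le> 1/4" using assms by (simp add: field_simps)
      then have "exp (b / (R * v)) \<le> exp (1/4)" by simp
      also have "exp (1/4 :: real) \<le> 4/3" using exp_ge_add_one_self[of "-1/4::real"] by (simp add: exp_minus field_simps)
      finally show "1/3 \<le> 1 - exp (b / (R * v)) / 2" by simp
    qed (use pos in auto)
    finally show "prob (?A j) \<le> 2 * exp (- (b\<^sup>2 / (3 * R * v)))" by (simp add: mult_ac)
  qed
  also have "\<dots> = real (card J) * (2 * exp (- (b\<^sup>2 / (3 * R * v))))" by simp
  finally show ?thesis .
qed

text \<open>Rounding a point of the grid of mesh \<open>1 / (N d)\<close> down to the coarser grid of mesh \<open>1 / N\<close>.\<close>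

lemma grid_remainder:
  assumes "N > 0" "d > 0"
  shows "0 \<le> real (j div d) / real N" "real (j div d) / real N \<le> real j / (real N * real d)"
    "real j / (real N * real d) - real (j div d) / real N \<le> 1 / real N"
proof -
  have j: "real j = real (j div d) * real d + real (j mod d)"
    using div_mult_mod_eq[of j d] by (metis of_nat_add of_nat_mult)
  have *: "real j / (real N * real d) - real (j div d) / real N = real (j mod d) / (real N * real d)"
    using assms by (simp add: j field_simps)
  show "0 \<le> real (j div d) / real N" by simp
  have "0 \<le> real (j mod d) / (real N * real d)" by simp
  with * show "real (j div d) / real N \<le> real j / (real N * real d)" by linarith
  have "real (j mod d) / (real N * real d) \<le> real d / (real N * real d)"
    using assms by (intro divide_right_mono) (auto intro: less_imp_le)
  with * show "real j / (real N * real d) - real (j div d) / real N \<le> 1 / real N"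
    using assms by simp
qed

text \<open>Two steps of chaining, for sample sizes up to \<open>2\<^sup>k\<^sup>+\<^sup>1\<close>. A single union bound over a fine grid is too costly,
  because for increments of fixed length \<open>1 / m\<close> the exponential bound decays only like a power of
  \<open>k\<close>. As \<open>m \<eta>\<^sup>2 \<ge> 6 * 3\<close>, it is at most \<open>k powr - 3\<close> up to a constant factor, and this pays for the \<open>m k + 1\<close>
  points of the intermediate grid of mesh \<open>1 / (m k)\<close>. Increments of length \<open>1 / (m k)\<close> have an exponent larger by the factor \<open>k\<close>, hence a bound \<open>k powr (- 3 k)\<close>, and this pays for the \<open>m k 2\<^sup>k + 1\<close> points of
  the grid of mesh \<open>1 / (m k 2\<^sup>k)\<close>. On that grid the discretisation error, at most \<open>2 / (m k)\<close>, is negligible.\<close>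

lemma oscillation:
  fixes m :: nat
  assumes "\<eta> > 0" and m: "m \<ge> 1" "real m * \<eta>\<^sup>2 \<ge> 18"
  shows "AE \<omega> in M. eventually (\<lambda>k. \<forall>n. real n \<le> 2 ^ (k + 1) \<longrightarrow> (\<forall>j \<le> m * k * 2 ^ k.
    \<bar>centred_count n (real j / (real m * real k * 2 ^ k)) \<omega> - centred_count n (real (j div (k * 2 ^ k)) / real m) \<omega>\<bar>
      \<le> 2 * (\<eta> * sqrt (2 ^ k * ln (real k))))) sequentially"
proof -
  define b where "b k = \<eta> * sqrt (2 ^ k * ln (real k))" for k :: nat
  define R :: "nat \<Rightarrow> real" where "R k = 2 ^ (k + 1)" for k
  \<comment> \<open>\<open>\<beta>1\<close> runs through the intermediate grid and \<open>\<alpha>1\<close> rounds to mesh \<open>1 / m\<close>; \<open>\<beta>2\<close> runs through the fine grid and \<open>\<alpha>2\<close> rounds to the intermediate one\<close>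
  define \<alpha>1 \<beta>1 where "\<alpha>1 k l = real (l div k) / real m" and "\<beta>1 k l = real l / (real m * real k)" for k l :: nat
  define \<alpha>2 \<beta>2 where "\<alpha>2 k j = real (j div 2 ^ k) / real (m * k)" and "\<beta>2 k j = real j / (real (m * k) * real (2 ^ k))" for k j :: nat
  define J1 J2 where "J1 k = {..m * k}" and "J2 k = {..m * k * 2 ^ k}" for k :: nat
  define A1 where "A1 k = {\<omega> \<in> space M. \<exists>n. real n \<le> R k \<and> (\<exists>j\<in>J1 k. b k \<le> \<bar>centred_count n (\<beta>1 k j) \<omega> - centred_count n (\<alpha>1 k j) \<omega>\<bar>)}" for k
  define A2 where "A2 k = {\<omega> \<in> space M. \<exists>n. real n \<le> R k \<and> (\<exists>j\<in>J2 k. b k \<le> \<bar>centred_count n (\<beta>2 k j) \<omega> - centred_count n (\<alpha>2 k j) \<omega>\<bar>)}" for k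
  have mpos: "real m > 0" using m by simp
  have "AE \<omega> in M. eventually (\<lambda>k. \<omega> \<notin> A1 k) sequentially"
  proof (rule borel_cantelli_eventually_le)
    show "A1 k \<in> events" for k unfolding A1_def J1_def by measurable
    have "eventually (\<lambda>k. b k \<le> R k * (1 / real m) / 4) sequentially"
      unfolding b_def R_def using mpos \<open>\<eta> > 0\<close> by real_asymp
    then show "eventually (\<lambda>k. prob (A1 k) \<le> (real m * real k + 1) * (2 * real k powr (-3))) sequentially"
      using eventually_gt_at_top[of 1]
    proof eventually_elim
      case (elim k)
      have "\<beta>1 k j \<le> 1" if "j \<in> J1 k" for j
      proof -
        have "real j \<le> real (m * k)" using that unfolding J1_def by (simp only: of_nat_le_iff atMost_iff)
        then show ?thesis using mpos elim by (simp add: \<beta>1_def field_simps)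
      qed
      then have "prob (A1 k) \<le> real (card (J1 k)) * (2 * exp (- ((b k)\<^sup>2 / (3 * R k * (1 / real m)))))"
        unfolding A1_def using elim mpos \<open>\<eta> > 0\<close> grid_remainder[of m k]
        by (intro maximal_inequality_increments) (auto simp: \<alpha>1_def \<beta>1_def b_def R_def J1_def)
      also have "(b k)\<^sup>2 / (3 * R k * (1 / real m)) = (real m * \<eta>\<^sup>2) * ln (real k) / 6"
        using elim by (simp add: b_def R_def power_mult_distrib field_simps)
      also have "exp (- ((real m * \<eta>\<^sup>2) * ln (real k) / 6)) \<le> exp (- (18 * ln (real k) / 6))"
        using m elim by (simp add: divide_right_mono mult_right_mono)
      also have "exp (- (18 * ln (real k) / 6)) = real k powr (-3)"
        using elim by (simp add: powr_def)
      finally have "prob (A1 k) \<le> real (card (J1 k)) * (2 * real k powr (-3))" by (simp add: mult_left_mono)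
      then show ?case by (simp add: J1_def algebra_simps)
    qed
    show "summable (\<lambda>k. (real m * real k + 1) * (2 * real k powr (-3)))"
    proof (rule summable_comparison_test_bigo)
      show "summable (\<lambda>k. norm (1 / real k ^ 2))" using inverse_power_summable[of 2, where 'a=real] by (simp add: field_simps)
      show "(\<lambda>k. (real m * real k + 1) * (2 * real k powr (-3))) \<in> O(\<lambda>k. 1 / real k ^ 2)"
        using mpos by real_asymp
    qed
  qed
  moreover have "AE \<omega> in M. eventually (\<lambda>k. \<omega> \<notin> A2 k) sequentially"
  proof (rule borel_cantelli_eventually_le)
    show "A2 k \<in> events" for k unfolding A2_def J2_def by measurable
    have "eventually (\<lambda>k. b k \<le> R k * (1 / (real m * real k)) / 4) sequentially"
      unfolding b_def R_def using mpos \<open>\<eta> > 0\<close> by real_asymp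
    then show "eventually (\<lambda>k. prob (A2 k) \<le> (real m * real k * 2 ^ k + 1) * (2 * real k powr (- 3 * real k))) sequentially"
      using eventually_gt_at_top[of 1]
    proof eventually_elim
      case (elim k)
      have "\<beta>2 k j \<le> 1" if "j \<in> J2 k" for j
      proof -
        have "real j \<le> real (m * k * 2 ^ k)" using that unfolding J2_def by (simp only: of_nat_le_iff atMost_iff)
        then show ?thesis using mpos elim by (simp add: \<beta>2_def field_simps)
      qed
      then have "prob (A2 k) \<le> real (card (J2 k)) * (2 * exp (- ((b k)\<^sup>2 / (3 * R k * (1 / real (m * k))))))"
        unfolding A2_def using elim mpos \<open>\<eta> > 0\<close> grid_remainder[of "m * k" "2 ^ k"] m
        by (intro maximal_inequality_increments) (auto simp: \<alpha>2_def \<beta>2_def b_def R_def J2_def)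
      also have "(b k)\<^sup>2 / (3 * R k * (1 / real (m * k))) = (real m * \<eta>\<^sup>2) * (real k * ln (real k)) / 6"
        using elim by (simp add: b_def R_def power_mult_distrib field_simps)
      also have "exp (- ((real m * \<eta>\<^sup>2) * (real k * ln (real k)) / 6)) \<le> exp (- (18 * (real k * ln (real k)) / 6))"
        using m elim by (simp add: divide_right_mono mult_right_mono)
      also have "exp (- (18 * (real k * ln (real k)) / 6)) = real k powr (-3 * real k)"
        using elim by (simp add: powr_def)
      finally have "prob (A2 k) \<le> real (card (J2 k)) * (2 * real k powr (-3 * real k))" by (simp add: mult_left_mono)
      then show ?case by (simp add: J2_def algebra_simps)
    qed
    show "summable (\<lambda>k. (real m * real k * 2 ^ k + 1) * (2 * real k powr (- 3 * real k)))"
    proof (rule summable_comparison_test_bigo)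
      show "summable (\<lambda>k. norm (1 / real k ^ 2))" using inverse_power_summable[of 2, where 'a=real] by (simp add: field_simps)
      show "(\<lambda>k. (real m * real k * 2 ^ k + 1) * (2 * real k powr (- 3 * real k))) \<in> O(\<lambda>k. 1 / real k ^ 2)"
        using mpos by real_asymp
    qed
  qed
  ultimately show ?thesis
    using AE_space
  proof eventually_elim
    case (elim \<omega>)
    show ?case using elim(1,2) eventually_gt_at_top[of 0]
    proof (eventually_elim, intro allI impI)
      fix k n j :: nat assume k: "\<omega> \<notin> A1 k" "\<omega> \<notin> A2 k" "0 < k" and n: "real n \<le> 2 ^ (k + 1)" and j: "j \<le> m * k * 2 ^ k"
      define l where "l = j div 2 ^ k"
      have l: "l \<in> J1 k" using j div_le_mono[OF j, of "2 ^ k"] unfolding l_def J1_def by simp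
      have "\<bar>centred_count n (\<beta>1 k l) \<omega> - centred_count n (\<alpha>1 k l) \<omega>\<bar> < b k"
        using k(1) elim(3) n l unfolding A1_def R_def by force
      moreover have "\<bar>centred_count n (\<beta>2 k j) \<omega> - centred_count n (\<alpha>2 k j) \<omega>\<bar> < b k"
        using k(2) elim(3) n j unfolding A2_def R_def J2_def by force
      moreover have "\<alpha>2 k j = \<beta>1 k l" by (simp add: \<alpha>2_def \<beta>1_def l_def)
      moreover have "\<alpha>1 k l = real (j div (k * 2 ^ k)) / real m"
        by (simp add: \<alpha>1_def l_def div_mult2_eq[symmetric] mult.commute)
      moreover have "\<beta>2 k j = real j / (real m * real k * 2 ^ k)" by (simp add: \<beta>2_def)
      ultimately show "\<bar>centred_count n (real j / (real m * real k * 2 ^ k)) \<omega> - centred_count n (real (j div (k * 2 ^ k)) / real m) \<omega>\<bar>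
          \<le> 2 * (\<eta> * sqrt (2 ^ k * ln (real k)))"
        unfolding b_def[symmetric] by (simp only:)
    qed
  qed
qed

text \<open>Monotonicity of counts controls every point by a neighbouring grid point. The number \<open>c\<close> may lie
  anywhere between the strict and the weak count at \<open>u\<close>: a distribution function that is flat on an
  interval makes \<open>{i. X\<^sub>i \<le> t}\<close> only a set between \<open>{i. U\<^sub>i < F t}\<close> and \<open>{i. U\<^sub>i \<le> F t}\<close>.\<close>

lemma centred_count_sandwich:
  assumes "L \<ge> 1" "0 \<le> u" "u \<le> 1"
    and c: "(\<Sum>i=1..n. indicator {..<u} (U i \<omega>)) \<le> c" "c \<le> (\<Sum>i=1..n. indicator {..u} (U i \<omega>))"
  shows "\<exists>j\<le>L. \<bar>real j / real L - u\<bar> \<le> 1 / real L \<and> \<bar>c - real n * u\<bar> \<le> \<bar>centred_count n (real j / real L) \<omega>\<bar> + real n / real L"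
proof -
  have L: "real L > 0" using assms by simp
  define j where "j = nat \<lceil>u * real L\<rceil>"
  have uL: "0 \<le> u * real L" "u * real L \<le> real L" using assms L by (auto simp: mult_left_le_one_le)
  have j: "u * real L \<le> real j" "real j < u * real L + 1" unfolding j_def using uL by linarith+
  have jL: "u \<le> real j / real L" "real j / real L \<le> u + 1 / real L" using j L by (auto simp: field_simps)
  have "real j < real L + 1" using j uL by linarith
  then have "j \<le> L" by linarith
  have centred_count: "centred_count n x \<omega> = (\<Sum>i=1..n. indicator {..x} (U i \<omega>)) - real n * x" for x
    by (simp add: centred_count_def sum_subtractf)
  show ?thesis
  proof (cases "c - real n * u \<ge> 0")
    case True
    have "(\<Sum>i=1..n. indicator {..u} (U i \<omega>) :: real) \<le> (\<Sum>i=1..n. indicator {..real j / real L} (U i \<omega>))"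
      using jL by (intro sum_mono) (auto simp: indicator_def)
    then have "c - real n * u \<le> centred_count n (real j / real L) \<omega> + real n * (real j / real L - u)"
      using c by (simp add: centred_count algebra_simps)
    also have "\<dots> \<le> centred_count n (real j / real L) \<omega> + real n * (1 / real L)"
      using jL by (intro add_left_mono mult_left_mono) auto
    finally show ?thesis using True jL \<open>j \<le> L\<close> by (intro exI[of _ j]) auto
  next
    case False
    have "0 \<le> c" using c(1) by (rule order.trans[rotated]) (simp add: sum_nonneg)
    with False have "u > 0" using \<open>0 \<le> u\<close> by (cases "u = 0") auto
    then have "u * real L > 0" using L by simp
    then have j1: "j \<ge> 1" unfolding j_def by linarith
    define x where "x = real (j - 1) / real L"
    have x: "x < u" "u - x \<le> 1 / real L" unfolding x_def using j j1 L by (auto simp: field_simps of_nat_diff)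
    have "(\<Sum>i=1..n. indicator {..x} (U i \<omega>) :: real) \<le> (\<Sum>i=1..n. indicator {..<u} (U i \<omega>))"
      using x by (intro sum_mono) (auto simp: indicator_def)
    then have "c - real n * u \<ge> centred_count n x \<omega> - real n * (u - x)"
      using c by (simp add: centred_count algebra_simps)
    moreover have "real n * (u - x) \<le> real n * (1 / real L)" using x by (intro mult_left_mono) auto
    ultimately have "\<bar>c - real n * u\<bar> \<le> \<bar>centred_count n x \<omega>\<bar> + real n / real L" using False by auto
    moreover have "\<bar>x - u\<bar> \<le> 1 / real L" using x by auto
    ultimately show ?thesis using \<open>j \<le> L\<close> unfolding x_def by (intro exI[of _ "j - 1"] conjI) auto
  qed
qed

text \<open>The pointwise law at the finitely many points \<open>i / m\<close>, combined with the oscillation bound for all other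
  points. As the envelope \<open>u \<mapsto> sqrt (2 u (1 - u))\<close> is uniformly continuous, a large \<open>m\<close> makes the
  result uniform in \<open>u\<close> with an arbitrarily small loss.\<close>

lemma lil_upper_uniform:
  assumes "\<epsilon> > 0"
  shows "AE \<omega> in M. eventually (\<lambda>n. \<forall>u c. 0 \<le> u \<longrightarrow> u \<le> 1 \<longrightarrow>
      (\<Sum>i=1..n. indicator {..<u} (U i \<omega>)) \<le> c \<longrightarrow> c \<le> (\<Sum>i=1..n. indicator {..u} (U i \<omega>)) \<longrightarrow>
      \<bar>c - real n * u\<bar> \<le> (sqrt (2 * (u * (1 - u))) + \<epsilon>) * sqrt (real n * ln (ln (real n)))) sequentially"
proof -
  define \<eta> where "\<eta> = \<epsilon> / 24"
  have \<eta>: "\<eta> > 0" using assms by (simp add: \<eta>_def)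
  \<comment> \<open>the first summand meets the hypothesis of the oscillation bound, the second makes the envelope vary by at most \<open>\<epsilon> / 4\<close> over a distance \<open>2 / m\<close>\<close>
  define m where "m = nat \<lceil>18 / \<eta>\<^sup>2\<rceil> + nat \<lceil>64 / \<epsilon>\<^sup>2\<rceil> + 1"
  have "real m \<ge> 18 / \<eta>\<^sup>2" "real m \<ge> 64 / \<epsilon>\<^sup>2" and m1: "m \<ge> 1"
    unfolding m_def by linarith+
  then have m18: "real m * \<eta>\<^sup>2 \<ge> 18" and m64: "real m * \<epsilon>\<^sup>2 \<ge> 64" using \<eta> assms by (auto simp: field_simps)
  have mpos: "real m > 0" using m1 by simp
  have "sqrt (4 / real m) \<le> \<epsilon> / 4"
    using m64 mpos assms by (intro real_le_lsqrt) (auto simp: field_simps power2_eq_square)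
  define a where "a n = sqrt (real n * ln (ln (real n)))" for n :: nat
  have grid: "AE \<omega> in M. eventually (\<lambda>n. \<bar>centred_count n (real i / real m) \<omega>\<bar> \<le>
      (sqrt (2 * (real i / real m * (1 - real i / real m))) + \<epsilon> / 4) * a n) sequentially" if "i \<le> m" for i
  proof -
    have "0 \<le> real i / real m" "real i / real m \<le> 1" using that mpos by auto
    then have "prob {\<omega> \<in> space M. U k \<omega> \<in> {..real i / real m}} = real i / real m" if "k \<ge> 1" for k
      using uniform_U[OF that] by simp
    from lil_upper_count[OF indep_U _ this, of "\<epsilon> / 4"] assms show ?thesis
      by (simp add: centred_count_def a_def)
  qed
  have "AE \<omega> in M. \<forall>i\<in>{..m}. eventually (\<lambda>n. \<bar>centred_count n (real i / real m) \<omega>\<bar> \<le>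
      (sqrt (2 * (real i / real m * (1 - real i / real m))) + \<epsilon> / 4) * a n) sequentially"
    by (rule AE_finite_allI) (use grid in auto)
  with oscillation[OF \<eta> m1 m18] show ?thesis
  proof eventually_elim
    case (elim \<omega>)
    have grid': "eventually (\<lambda>n. \<forall>i\<in>{..m}. \<bar>centred_count n (real i / real m) \<omega>\<bar> \<le>
      (sqrt (2 * (real i / real m * (1 - real i / real m))) + \<epsilon> / 4) * a n) sequentially"
      using elim(2) by (simp add: eventually_ball_finite)
    define bk where "bk k = \<eta> * sqrt (2 ^ k * ln (real k))" for k :: nat
    define P where "P n \<longleftrightarrow> (\<forall>u. 0 \<le> u \<longrightarrow> u \<le> 1 \<longrightarrow> (\<forall>c.
      (\<Sum>i=1..n. indicator {..<u} (U i \<omega>)) \<le> c \<longrightarrow> c \<le> (\<Sum>i=1..n. indicator {..u} (U i \<omega>)) \<longrightarrow>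
      (\<exists>i\<le>m. \<bar>real i / real m - u\<bar> \<le> 2 / real m \<and> \<bar>c - real n * u\<bar> \<le> \<bar>centred_count n (real i / real m) \<omega>\<bar> + 6 * \<eta> * a n)))" for n
    have "eventually P sequentially"
    proof (rule eventually_geometric_blocks[of 2])
      have e1: "eventually (\<lambda>k. 2 / (real m * real k) \<le> bk k) sequentially"
        unfolding bk_def using \<eta> mpos by real_asymp
      have e2: "eventually (\<lambda>k::nat. ln (real k) \<le> 4 * ln (real k * ln 2)) sequentially"
        by real_asymp
      have e3: "eventually (\<lambda>k::nat. ln (real k * ln 2) > 0) sequentially"
        by real_asymp
      show "eventually (\<lambda>k. \<forall>n. (2::real) ^ k \<le> real n \<and> real n \<le> 2 ^ (k + 1) \<longrightarrow> P n) sequentially"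
        using elim(1) e1 e2 e3 eventually_gt_at_top[of 0]
      proof (eventually_elim, intro allI impI)
        fix k n :: nat
        assume osc: "\<forall>n. real n \<le> 2 ^ (k + 1) \<longrightarrow> (\<forall>j \<le> m * k * 2 ^ k.
            \<bar>centred_count n (real j / (real m * real k * 2 ^ k)) \<omega> - centred_count n (real (j div (k * 2 ^ k)) / real m) \<omega>\<bar>
            \<le> 2 * (\<eta> * sqrt (2 ^ k * ln (real k))))"
          and k: "2 / (real m * real k) \<le> bk k" "ln (real k) \<le> 4 * ln (real k * ln 2)" "ln (real k * ln 2) > 0" "k > 0"
          and n: "(2::real) ^ k \<le> real n \<and> real n \<le> 2 ^ (k + 1)"
        define L where "L = m * k * 2 ^ k"
        have L: "L \<ge> 1" using m1 k by (simp add: L_def)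
        have Lr: "real L = real m * real k * 2 ^ k" by (simp add: L_def)
        have nL: "real n / real L \<le> bk k"
        proof -
          have "real n / real L \<le> 2 ^ (k + 1) / real L" using n by (intro divide_right_mono) auto
          also have "\<dots> = 2 / (real m * real k)" by (simp add: Lr field_simps)
          finally show ?thesis using k by linarith
        qed
        have bka: "bk k \<le> 2 * \<eta> * a n"
        proof -
          have n0: "real n > 0" using n less_le_trans[of 0 "2 ^ k" "real n"] by simp
          have "real k * ln 2 = ln (2 ^ k)" by (simp add: ln_realpow)
          also have "\<dots> \<le> ln (real n)" using n n0 by (subst ln_le_cancel_iff) auto
          finally have "ln (real k * ln 2) \<le> ln (ln (real n))" using k
            by (subst ln_le_cancel_iff) (auto intro: less_le_trans[rotated])
          then have "2 ^ k * ln (real k) \<le> real n * (4 * ln (ln (real n)))" using k n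
            by (intro mult_mono) auto
          then have "sqrt (2 ^ k * ln (real k)) \<le> sqrt (4 * (real n * ln (ln (real n))))"
            by (intro real_sqrt_le_mono) (simp add: mult_ac)
          also have "\<dots> = 2 * a n" by (simp add: a_def real_sqrt_mult)
          finally show ?thesis using \<eta> by (simp add: bk_def)
        qed
        show "P n" unfolding P_def
        proof (intro allI impI)
          fix u c :: real
          assume u: "0 \<le> u" "u \<le> 1" and c: "(\<Sum>i=1..n. indicator {..<u} (U i \<omega>)) \<le> c" "c \<le> (\<Sum>i=1..n. indicator {..u} (U i \<omega>))"
          from centred_count_sandwich[OF L u c] obtain j where j: "j \<le> L" "\<bar>real j / real L - u\<bar> \<le> 1 / real L"
            "\<bar>c - real n * u\<bar> \<le> \<bar>centred_count n (real j / real L) \<omega>\<bar> + real n / real L" by blast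
          define i where "i = j div (k * 2 ^ k)"
          have "\<bar>centred_count n (real j / real L) \<omega> - centred_count n (real i / real m) \<omega>\<bar> \<le> 2 * bk k"
            using osc n j(1) unfolding L_def[symmetric] Lr i_def bk_def by blast
          then have "\<bar>c - real n * u\<bar> \<le> \<bar>centred_count n (real i / real m) \<omega>\<bar> + 6 * \<eta> * a n"
            using j(3) nL bka by linarith
          moreover have "i \<le> m"
            unfolding i_def using div_le_mono[OF j(1), of "k * 2 ^ k"] k unfolding L_def by (simp add: mult.assoc)
          moreover have "\<bar>real i / real m - u\<bar> \<le> 2 / real m"
          proof -
            have "1 / real L \<le> 1 / real m"
            proof -
              have "m * 1 \<le> m * (k * 2 ^ k)" using k by (intro mult_le_mono2) auto
              then have "real m \<le> real L" unfolding L_def by (simp only: of_nat_le_iff mult.assoc mult_1_right)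
              then show ?thesis using mpos by (simp add: field_simps)
            qed
            moreover have "real i / real m \<le> real j / real L" "real j / real L - real i / real m \<le> 1 / real m"
              using grid_remainder(2,3)[of m "k * 2 ^ k" j] k m1 unfolding i_def Lr by (simp_all add: mult.assoc)
            moreover have "2 / real m = 1 / real m + 1 / real m" by simp
            ultimately show ?thesis using j(2) by linarith
          qed
          ultimately show "\<exists>i\<le>m. \<bar>real i / real m - u\<bar> \<le> 2 / real m \<and> \<bar>c - real n * u\<bar> \<le> \<bar>centred_count n (real i / real m) \<omega>\<bar> + 6 * \<eta> * a n"
            by blast
        qed
      qed
    qed simp
    moreover have "eventually (\<lambda>n. a n \<ge> 0) sequentially" unfolding a_def by real_asymp
    ultimately show ?case using grid'
    proof (eventually_elim, intro allI impI)
      fix n :: nat and u c :: real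
      assume P: "P n" and a: "a n \<ge> 0" and g: "\<forall>i\<in>{..m}. \<bar>centred_count n (real i / real m) \<omega>\<bar> \<le>
          (sqrt (2 * (real i / real m * (1 - real i / real m))) + \<epsilon> / 4) * a n"
        and u: "0 \<le> u" "u \<le> 1" and c: "(\<Sum>i=1..n. indicator {..<u} (U i \<omega>)) \<le> c" "c \<le> (\<Sum>i=1..n. indicator {..u} (U i \<omega>))"
      from P u c obtain i where i: "i \<le> m" "\<bar>real i / real m - u\<bar> \<le> 2 / real m"
        "\<bar>c - real n * u\<bar> \<le> \<bar>centred_count n (real i / real m) \<omega>\<bar> + 6 * \<eta> * a n"
        unfolding P_def by blast
      define x where "x = real i / real m"
      have x01: "0 \<le> x" "x \<le> 1" using i mpos by (auto simp: x_def)
      have "x * (1 - x) \<le> u * (1 - u) + \<bar>x - u\<bar>"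
      proof -
        have "x * (1 - x) - u * (1 - u) = (x - u) * (1 - x - u)" by (simp add: algebra_simps)
        also have "\<dots> \<le> \<bar>x - u\<bar> * \<bar>1 - x - u\<bar>" by (metis abs_ge_self abs_mult)
        also have "\<dots> \<le> \<bar>x - u\<bar> * 1" using x01 u by (intro mult_left_mono) auto
        finally show ?thesis by simp
      qed
      then have "2 * (x * (1 - x)) \<le> 2 * (u * (1 - u)) + 4 / real m" using i(2) unfolding x_def[symmetric] by simp
      then have "sqrt (2 * (x * (1 - x))) \<le> sqrt (2 * (u * (1 - u)) + 4 / real m)" by simp
      also have "\<dots> \<le> sqrt (2 * (u * (1 - u))) + sqrt (4 / real m)"
        using u mpos by (intro sqrt_add_le_add_sqrt) auto
      also have "\<dots> \<le> sqrt (2 * (u * (1 - u))) + \<epsilon> / 4" using \<open>sqrt (4 / real m) \<le> \<epsilon> / 4\<close> by simp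
      finally have "(sqrt (2 * (x * (1 - x))) + \<epsilon> / 4) + 6 * \<eta> \<le> sqrt (2 * (u * (1 - u))) + \<epsilon>"
        using assms by (simp add: \<eta>_def)
      from mult_right_mono[OF this a] have "(sqrt (2 * (x * (1 - x))) + \<epsilon> / 4) * a n + 6 * \<eta> * a n \<le> (sqrt (2 * (u * (1 - u))) + \<epsilon>) * a n"
        by (simp add: distrib_right)
      moreover have "\<bar>centred_count n x \<omega>\<bar> \<le> (sqrt (2 * (x * (1 - x))) + \<epsilon> / 4) * a n" using g i(1) unfolding x_def by blast
      ultimately show "\<bar>c - real n * u\<bar> \<le> (sqrt (2 * (u * (1 - u))) + \<epsilon>) * sqrt (real n * ln (ln (real n)))"
        using i(3) unfolding x_def[symmetric] a_def[symmetric] by linarith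
    qed
  qed
qed

end

section \<open>The lower law of the iterated logarithm for counts\<close>

context prob_space
begin

lemma indep_vars_inj_reindex:
  assumes ind: "indep_vars (\<lambda>_. N) X I" and "inj_on f J" "f ` J \<subseteq> I"
  shows "indep_vars (\<lambda>_. N) (\<lambda>j. X (f j)) J"
proof -
  have "indep_vars (\<lambda>j. PiM {f j} (\<lambda>_. N)) (\<lambda>j \<omega>. restrict (\<lambda>i. X i \<omega>) {f j}) J"
    using assms(2,3) by (intro indep_vars_restrict[OF ind]) (auto simp: disjoint_family_on_def inj_on_def)
  then have "indep_vars (\<lambda>_. N) (\<lambda>j \<omega>. (\<lambda>z. z (f j)) (restrict (\<lambda>i. X i \<omega>) {f j})) J"
    by (rule indep_vars_compose2) (auto intro: measurable_component_singleton)
  then show ?thesis by simp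
qed

text \<open>The central limit theorem concerns initial segments only; stationarity carries its consequence
  over to all blocks of the same length.\<close>

lemma iid_block_distr:
  fixes Y :: "nat \<Rightarrow> 'a \<Rightarrow> real"
  assumes ind: "indep_vars (\<lambda>_. borel) Y {1..}" and id: "\<And>i. i \<ge> 1 \<Longrightarrow> distr M borel (Y i) = \<mu>"
  shows "prob {\<omega> \<in> space M. c \<le> (\<Sum>i=s+1..s+l. Y i \<omega>)} = prob {\<omega> \<in> space M. c \<le> (\<Sum>i=1..l. Y i \<omega>)}"
proof (cases "l = 0")
  case False
  have Y: "Y i \<in> borel_measurable M" if "i \<ge> 1" for i using ind that by (auto simp: indep_vars_def)
  have *: "prob {\<omega> \<in> space M. c \<le> (\<Sum>i=s+1..s+l. Y i \<omega>)} =
      measure (PiM {1..l} (\<lambda>_. \<mu>)) {z \<in> space (PiM {1..l} (\<lambda>_. borel)). c \<le> (\<Sum>i=1..l. z i)}" for s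
  proof -
    let ?P = "PiM {1..l} (\<lambda>_. borel) :: (nat \<Rightarrow> real) measure"
    have "indep_vars (\<lambda>_. borel) (\<lambda>j. Y (s + j)) {1..l}"
      by (rule indep_vars_inj_reindex[OF ind]) auto
    then have "distr M ?P (\<lambda>\<omega>. \<lambda>j\<in>{1..l}. Y (s + j) \<omega>) = PiM {1..l} (\<lambda>j. distr M borel (Y (s + j)))"
      using False Y by (subst (asm) indep_vars_iff_distr_eq_PiM') auto
    also have "\<dots> = PiM {1..l} (\<lambda>_. \<mu>)" by (rule PiM_cong) (use id in auto)
    finally have d: "distr M ?P (\<lambda>\<omega>. \<lambda>j\<in>{1..l}. Y (s + j) \<omega>) = PiM {1..l} (\<lambda>_. \<mu>)" .
    have meas: "(\<lambda>\<omega>. \<lambda>j\<in>{1..l}. Y (s + j) \<omega>) \<in> measurable M ?P"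
      by (intro measurable_restrict Y) auto
    have S: "{z \<in> space ?P. c \<le> (\<Sum>i=1..l. z i)} \<in> sets ?P"
    proof -
      have [measurable]: "(\<lambda>z. \<Sum>i=1..l. z i) \<in> borel_measurable ?P"
        by (intro borel_measurable_sum measurable_component_singleton)
      show ?thesis by measurable
    qed
    have "prob {\<omega> \<in> space M. c \<le> (\<Sum>i=s+1..s+l. Y i \<omega>)} =
      prob ((\<lambda>\<omega>. \<lambda>j\<in>{1..l}. Y (s + j) \<omega>) -` {z \<in> space ?P. c \<le> (\<Sum>i=1..l. z i)} \<inter> space M)"
    proof (rule arg_cong[where f=prob])
      have "(\<Sum>i=s+1..s+l. Y i \<omega>) = (\<Sum>j=1..l. Y (s + j) \<omega>)" for \<omega>
        by (rule sum.reindex_bij_witness[of _ "\<lambda>j. s + j" "\<lambda>i. i - s"]) auto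
      then show "{\<omega> \<in> space M. c \<le> (\<Sum>i=s+1..s+l. Y i \<omega>)} =
        (\<lambda>\<omega>. \<lambda>j\<in>{1..l}. Y (s + j) \<omega>) -` {z \<in> space ?P. c \<le> (\<Sum>i=1..l. z i)} \<inter> space M"
        by (auto simp: space_PiM)
    qed
    also have "\<dots> = measure (distr M ?P (\<lambda>\<omega>. \<lambda>j\<in>{1..l}. Y (s + j) \<omega>)) {z \<in> space ?P. c \<le> (\<Sum>i=1..l. z i)}"
      by (rule measure_distr[OF meas S, symmetric])
    finally show ?thesis unfolding d .
  qed
  show ?thesis using *[of s] *[of 0] by simp
qed simp

text \<open>The second Borel-Cantelli lemma, stated for variables rather than events, so that complements need no
  separate independence argument.\<close>

lemma second_borel_cantelli:
  fixes W :: "nat \<Rightarrow> 'a \<Rightarrow> 'b"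
  assumes ind: "indep_vars N W {k0..}" and S: "\<And>k. k \<ge> k0 \<Longrightarrow> S k \<in> sets (N k)"
    and div: "\<not> summable (\<lambda>k. prob {\<omega> \<in> space M. W k \<omega> \<in> S k})"
  shows "AE \<omega> in M. \<exists>\<^sub>F k in sequentially. W k \<omega> \<in> S k"
proof -
  define p where "p k = prob {\<omega> \<in> space M. W k \<omega> \<in> S k}" for k
  have W[measurable]: "W k \<in> measurable M (N k)" if "k \<ge> k0" for k using ind that by (auto simp: indep_vars_def)
  have ev: "{\<omega> \<in> space M. W k \<omega> \<in> S k} \<in> events" if "k \<ge> k0" for k
    using measurable_sets[OF W[OF that] S[OF that]] by (simp add: vimage_def Int_def conj_commute)
  define C where "C K n = {\<omega> \<in> space M. \<forall>k\<in>{K..<K + n}. W k \<omega> \<notin> S k}" for K n :: nat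
  have C: "C K n \<in> events" if "K \<ge> k0" for K n
  proof -
    have "C K n = space M - (\<Union>k\<in>{K..<K+n}. {\<omega> \<in> space M. W k \<omega> \<in> S k})" by (auto simp: C_def)
    also have "\<dots> \<in> events" using ev that by (intro sets.Diff sets.finite_UN sets.top) auto
    finally show ?thesis .
  qed
  have bound: "prob (C K n) \<le> exp (- (\<Sum>k=K..<K + n. p k))" if K: "K \<ge> k0" for K n
  proof (cases "n = 0")
    case False
    have "C K n = (\<Inter>k\<in>{K..<K+n}. W k -` (space (N k) - S k) \<inter> space M)"
      using False K measurable_space[OF W] by (fastforce simp: C_def)
    also have "prob \<dots> = (\<Prod>k=K..<K+n. prob (W k -` (space (N k) - S k) \<inter> space M))"
      using False K S by (intro indep_varsD[OF ind]) auto
    also have "\<dots> \<le> (\<Prod>k=K..<K+n. exp (- p k))"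
    proof (intro prod_mono conjI)
      fix k assume k: "k \<in> {K..<K+n}"
      have "W k -` (space (N k) - S k) \<inter> space M = space M - {\<omega> \<in> space M. W k \<omega> \<in> S k}"
        using K k measurable_space[OF W, of k] by auto
      also have "prob \<dots> = 1 - p k" unfolding p_def using K k by (intro prob_compl ev) auto
      also have "\<dots> \<le> exp (- p k)" using exp_ge_add_one_self[of "- p k"] by simp
      finally show "prob (W k -` (space (N k) - S k) \<inter> space M) \<le> exp (- p k)" .
    qed simp
    also have "\<dots> = exp (- (\<Sum>k=K..<K + n. p k))" by (simp add: exp_sum sum_negf[symmetric])
    finally show ?thesis .
  qed simp
  have "AE \<omega> in M. \<exists>n. \<omega> \<notin> C K n" if K: "K \<ge> k0" for K
  proof -
    have "prob (\<Inter>n. C K n) \<le> 0"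
    proof (rule field_le_epsilon)
      fix e :: real assume "e > 0"
      have "\<not> summable p" using div by (simp add: p_def[abs_def])
      then have "\<not> summable (\<lambda>n. p (n + K))" using summable_iff_shift[of p K] by simp
      then have "\<not> (\<forall>n. (\<Sum>i<n. p (i + K)) \<le> ln (1 / e))"
        using summableI_nonneg_bounded[of "\<lambda>n. p (n + K)" "ln (1 / e)"] by (auto simp: p_def)
      then obtain n where n: "(\<Sum>i<n. p (i + K)) > ln (1 / e)" by (auto simp: not_le)
      have "(\<Sum>k=K..<K + n. p k) = (\<Sum>i<n. p (i + K))"
        using sum.shift_bounds_nat_ivl[of p 0 K n] by (simp add: atLeast0LessThan add.commute)
      with n have "- (\<Sum>k=K..<K + n. p k) \<le> ln e" using \<open>e > 0\<close> by (simp add: ln_div)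
      then have "exp (- (\<Sum>k=K..<K + n. p k)) \<le> e" using \<open>e > 0\<close> by (metis exp_le_cancel_iff exp_ln)
      moreover have "prob (\<Inter>n. C K n) \<le> prob (C K n)" by (intro finite_measure_mono C K) auto
      ultimately show "prob (\<Inter>n. C K n) \<le> 0 + e" using bound[OF K, of n] by linarith
    qed
    then have "prob (\<Inter>n. C K n) = 0" by (simp add: measure_le_0_iff)
    moreover have "(\<Inter>n. C K n) \<in> events" using C[OF K] by (intro sets.countable_INT) auto
    ultimately have "AE \<omega> in M. \<omega> \<notin> (\<Inter>n. C K n)" by (simp add: prob_eq_0 flip: AE_iff_null)
    then show ?thesis by simp
  qed
  then have "AE \<omega> in M. \<forall>K\<in>{k0..}. \<exists>n. \<omega> \<notin> C K n" by (subst AE_ball_countable) auto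
  then show ?thesis using AE_space
  proof eventually_elim
    case (elim \<omega>)
    show ?case unfolding frequently_sequentially
    proof
      fix K0
      obtain n where "\<omega> \<notin> C (max K0 k0) n" using elim(1) by force
      then show "\<exists>k\<ge>K0. W k \<omega> \<in> S k" using elim(2) by (auto simp: C_def)
    qed
  qed
qed

end

lemma std_normal_tail_lower:
  fixes K :: real
  assumes "K \<ge> 0"
  shows "1 - cdf std_normal_distribution K \<ge> exp (- ((K + 1)\<^sup>2) / 2) / sqrt (2 * pi)"
proof -
  interpret real_distribution std_normal_distribution by (rule real_dist_normal_dist)
  let ?c = "exp (- ((K + 1)\<^sup>2) / 2) / sqrt (2 * pi)"
  have "ennreal ?c = (\<integral>\<^sup>+x. ennreal ?c * indicator {K<..K+1} x \<partial>lborel)"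
    by (subst nn_integral_cmult_indicator) auto
  also have "\<dots> \<le> (\<integral>\<^sup>+x. ennreal (std_normal_density x) * indicator {K<..K+1} x \<partial>lborel)"
  proof (intro nn_integral_mono)
    fix x :: real
    show "ennreal ?c * indicator {K<..K+1} x \<le> ennreal (std_normal_density x) * indicator {K<..K+1} x"
    proof (cases "x \<in> {K<..K+1}")
      case True
      then have "x\<^sup>2 \<le> (K + 1)\<^sup>2" using assms by (intro power_mono) auto
      then show ?thesis using True by (auto simp: std_normal_density_def intro!: ennreal_leI divide_right_mono)
    qed simp
  qed
  also have "\<dots> = emeasure std_normal_distribution {K<..K+1}" by (subst emeasure_density) auto
  also have "\<dots> = ennreal (prob {K<..K+1})" by (rule emeasure_eq_measure)
  finally have "?c \<le> prob {K<..K+1}" by (subst (asm) ennreal_le_iff) auto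
  also have "\<dots> \<le> prob (UNIV - {..K})" by (intro finite_measure_mono) auto
  also have "\<dots> = 1 - cdf std_normal_distribution K"
    using prob_compl[of "{..K}"] by (simp add: cdf_def)
  finally show ?thesis .
qed

lemma isCont_cdf_std_normal: "isCont (cdf std_normal_distribution) K"
proof -
  interpret real_distribution std_normal_distribution by (rule real_dist_normal_dist)
  have "emeasure std_normal_distribution {K} = (\<integral>\<^sup>+x. ennreal (std_normal_density x) * indicator {K} x \<partial>lborel)"
    by (subst emeasure_density) auto
  also have "\<dots> = 0" by (subst nn_integral_indicator_singleton) auto
  finally show ?thesis by (simp add: isCont_cdf measure_def)
qed

context prob_space
begin

text \<open>A lower bound for the upper tail at a fixed level \<open>K\<close>, from the central limit theorem. Taking \<open>K\<close> large makes the
  polynomial loss in the Gaussian tail fit into the factor \<open>1 + \<delta>\<close> of the exponent.\<close>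

lemma clt_tail_lower_bound:
  fixes Y :: "nat \<Rightarrow> 'a \<Rightarrow> real"
  assumes ind: "indep_vars (\<lambda>_. borel) Y {1..}" and id: "\<And>i. i \<ge> 1 \<Longrightarrow> distr M borel (Y i) = \<mu>"
    and mean: "\<And>i. i \<ge> 1 \<Longrightarrow> expectation (Y i) = 0"
    and var: "\<And>i. i \<ge> 1 \<Longrightarrow> expectation (\<lambda>\<omega>. (Y i \<omega>)\<^sup>2) = \<sigma>\<^sup>2"
    and int: "\<And>i. i \<ge> 1 \<Longrightarrow> integrable M (\<lambda>\<omega>. (Y i \<omega>)\<^sup>2)" and "\<sigma> > 0" "\<delta> > 0"
  shows "\<exists>K>0. eventually (\<lambda>l. prob {\<omega> \<in> space M. K * \<sigma> * sqrt (real l) \<le> (\<Sum>i=1..l. Y i \<omega>)} \<ge>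
    exp (- ((1 + \<delta>) * K\<^sup>2 / 2))) sequentially"
proof -
  have Y: "Y i \<in> borel_measurable M" if "i \<ge> 1" for i using ind that by (auto simp: indep_vars_def)
  have "eventually (\<lambda>K::real. exp (- ((K + 1)\<^sup>2) / 2) / sqrt (2 * pi) > exp (- ((1 + \<delta>) * K\<^sup>2 / 2))) at_top"
    using \<open>\<delta> > 0\<close> by real_asymp
  then have "eventually (\<lambda>K::real. exp (- ((K + 1)\<^sup>2) / 2) / sqrt (2 * pi) > exp (- ((1 + \<delta>) * K\<^sup>2 / 2)) \<and> K > 0) at_top"
    using eventually_gt_at_top[of 0] by (rule eventually_conj)
  then obtain K where K: "K > 0" "exp (- ((K + 1)\<^sup>2) / 2) / sqrt (2 * pi) > exp (- ((1 + \<delta>) * K\<^sup>2 / 2))"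
    by (auto simp: eventually_at_top_linorder)
  let ?D = "\<lambda>l. distr M borel (\<lambda>\<omega>. (\<Sum>i<l. Y (Suc i) \<omega>) / sqrt (real l * \<sigma>\<^sup>2))"
  have "weak_conv_m ?D std_normal_distribution"
  proof (rule central_limit_theorem_zero_mean[where \<mu>=\<mu>])
    show "indep_vars (\<lambda>i. borel) (\<lambda>i. Y (Suc i)) UNIV"
      by (rule indep_vars_inj_reindex[OF ind]) auto
  qed (use assms in auto)
  then have "(\<lambda>l. cdf (?D l) K) \<longlonglongrightarrow> cdf std_normal_distribution K"
    unfolding weak_conv_m_def weak_conv_def using isCont_cdf_std_normal by blast
  then have "(\<lambda>l. 1 - cdf (?D l) K) \<longlonglongrightarrow> 1 - cdf std_normal_distribution K"
    by (intro tendsto_intros)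
  moreover have "1 - cdf std_normal_distribution K > exp (- ((1 + \<delta>) * K\<^sup>2 / 2))"
    using std_normal_tail_lower[of K] K by linarith
  ultimately have "eventually (\<lambda>l. 1 - cdf (?D l) K > exp (- ((1 + \<delta>) * K\<^sup>2 / 2))) sequentially"
    by (rule order_tendstoD)
  then have "eventually (\<lambda>l. prob {\<omega> \<in> space M. K * \<sigma> * sqrt (real l) \<le> (\<Sum>i=1..l. Y i \<omega>)} \<ge>
    exp (- ((1 + \<delta>) * K\<^sup>2 / 2))) sequentially"
    using eventually_gt_at_top[of 0]
  proof eventually_elim
    case (elim l)
    let ?T = "\<lambda>\<omega>. (\<Sum>i<l. Y (Suc i) \<omega>) / sqrt (real l * \<sigma>\<^sup>2)"
    have T[measurable]: "?T \<in> borel_measurable M"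
      by (intro borel_measurable_divide borel_measurable_sum Y) auto
    have "cdf (?D l) K = prob {\<omega> \<in> space M. ?T \<omega> \<le> K}"
      unfolding cdf_def by (subst measure_distr) (auto intro!: arg_cong[where f=prob])
    then have "1 - cdf (?D l) K = prob (space M - {\<omega> \<in> space M. ?T \<omega> \<le> K})"
      by (subst prob_compl) auto
    also have "\<dots> \<le> prob {\<omega> \<in> space M. K * \<sigma> * sqrt (real l) \<le> (\<Sum>i=1..l. Y i \<omega>)}"
    proof (rule finite_measure_mono)
      have "(\<lambda>\<omega>. \<Sum>i=1..l. Y i \<omega>) \<in> borel_measurable M" by (intro borel_measurable_sum Y) auto
      then show "{\<omega> \<in> space M. K * \<sigma> * sqrt (real l) \<le> (\<Sum>i=1..l. Y i \<omega>)} \<in> events" by measurable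
      have eq: "(\<Sum>i<l. Y (Suc i) \<omega>) = (\<Sum>i=1..l. Y i \<omega>)" for \<omega>
        by (rule sum.reindex_bij_witness[of _ "\<lambda>i. i - 1" Suc]) auto
      have sq: "sqrt (real l * \<sigma>\<^sup>2) = \<sigma> * sqrt (real l)" using \<open>\<sigma> > 0\<close> by (simp add: real_sqrt_mult)
      have "\<sigma> * sqrt (real l) > 0" using \<open>\<sigma> > 0\<close> elim by simp
      then show "space M - {\<omega> \<in> space M. ?T \<omega> \<le> K} \<subseteq> {\<omega> \<in> space M. K * \<sigma> * sqrt (real l) \<le> (\<Sum>i=1..l. Y i \<omega>)}"
        unfolding eq sq by (auto simp: divide_le_eq mult_ac)
    qed
    finally show ?case using elim by linarith
  qed
  with K(1) show ?thesis by blast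
qed

lemma prob_all_blocks_large:
  fixes Y :: "nat \<Rightarrow> 'a \<Rightarrow> real"
  assumes ind: "indep_vars (\<lambda>_. borel) Y {1..}" and id: "\<And>i. i \<ge> 1 \<Longrightarrow> distr M borel (Y i) = \<mu>"
  shows "prob {\<omega> \<in> space M. \<forall>j\<in>{1..r}. c \<le> (\<Sum>i=j*l+1..j*l+l. Y i \<omega>)} =
    prob {\<omega> \<in> space M. c \<le> (\<Sum>i=1..l. Y i \<omega>)} ^ r"
proof (cases "r = 0")
  case False
  define Bl where "Bl j = {j*l+1..j*l+l}" for j
  have disj: "disjoint_family_on Bl {1..r}"
  proof -
    have "Bl i \<inter> Bl j = {}" if "i < j" for i j
    proof -
      have "(i + 1) * l \<le> j * l" using that by (intro mult_right_mono) auto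
      then show ?thesis by (auto simp: Bl_def)
    qed
    then show ?thesis unfolding disjoint_family_on_def by (metis Int_commute nat_neq_iff)
  qed
  have "indep_vars (\<lambda>j. PiM (Bl j) (\<lambda>_. borel)) (\<lambda>j \<omega>. restrict (\<lambda>i. Y i \<omega>) (Bl j)) {1..r}"
    by (rule indep_vars_restrict[OF ind _ disj]) (auto simp: Bl_def)
  then have "indep_vars (\<lambda>_. borel) (\<lambda>j \<omega>. (\<lambda>z. \<Sum>i\<in>Bl j. z i) (restrict (\<lambda>i. Y i \<omega>) (Bl j))) {1..r}"
    by (rule indep_vars_compose2) (intro borel_measurable_sum measurable_component_singleton)
  then have ind': "indep_vars (\<lambda>_. borel) (\<lambda>j \<omega>. \<Sum>i\<in>Bl j. Y i \<omega>) {1..r}" by simp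
  have "{\<omega> \<in> space M. \<forall>j\<in>{1..r}. c \<le> (\<Sum>i=j*l+1..j*l+l. Y i \<omega>)} =
    (\<Inter>j\<in>{1..r}. (\<lambda>\<omega>. \<Sum>i\<in>Bl j. Y i \<omega>) -` {c..} \<inter> space M)"
    using False by (auto simp: Bl_def)
  also have "prob \<dots> = (\<Prod>j=1..r. prob ((\<lambda>\<omega>. \<Sum>i\<in>Bl j. Y i \<omega>) -` {c..} \<inter> space M))"
    using False by (intro indep_varsD_finite[OF ind']) auto
  also have "\<dots> = (\<Prod>j=1..r. prob {\<omega> \<in> space M. c \<le> (\<Sum>i=1..l. Y i \<omega>)})"
  proof (intro prod.cong refl)
    fix j
    have "(\<lambda>\<omega>. \<Sum>i\<in>Bl j. Y i \<omega>) -` {c..} \<inter> space M = {\<omega> \<in> space M. c \<le> (\<Sum>i=j*l+1..j*l+l. Y i \<omega>)}"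
      by (auto simp: Bl_def)
    then show "prob ((\<lambda>\<omega>. \<Sum>i\<in>Bl j. Y i \<omega>) -` {c..} \<inter> space M) = prob {\<omega> \<in> space M. c \<le> (\<Sum>i=1..l. Y i \<omega>)}"
      using iid_block_distr[OF ind id, of c "j*l" l] by simp
  qed
  finally show ?thesis by simp
qed (simp add: prob_space)

lemma sum_blocks:
  fixes y :: "nat \<Rightarrow> real"
  shows "(\<Sum>i=1..(r+1)*l. y i) = (\<Sum>i=1..l. y i) + (\<Sum>j=1..r. \<Sum>i=j*l+1..j*l+l. y i)"
proof (induction r)
  case (Suc r)
  have "(Suc r + 1) * l = (r + 1) * l + l" by simp
  then have "(\<Sum>i=1..(Suc r + 1) * l. y i) = (\<Sum>i=1..(r+1)*l. y i) + (\<Sum>i=(r + 1) * l + 1..(r + 1) * l + l. y i)"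
    by (simp only:) (rule sum.ub_add_nat, simp)
  with Suc show ?case by simp
qed simp

text \<open>Take \<open>l\<^sub>k = k\<^sup>k\<close> and divide the indices from \<open>l\<^sub>k + 1\<close> to \<open>N\<^sub>k = (r\<^sub>k + 1) l\<^sub>k\<close> into \<open>r\<^sub>k\<close> blocks of length \<open>l\<^sub>k\<close>,
  where \<open>r\<^sub>k\<close> is about \<open>\<beta> ln k\<close>. The event that every block sum is at least \<open>K \<sigma> sqrt l\<^sub>k\<close> has
  probability at least \<open>exp (- (1 + \<delta>) K\<^sup>2 / 2) ^ r\<^sub>k \<ge> 1 / k\<close> if \<open>\<beta> = 2 / ((1 + \<delta>) K\<^sup>2)\<close>, and these events
  concern disjoint index sets, so infinitely many occur. On such an event the \<open>r\<^sub>k\<close> blocks contribute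
  \<open>r\<^sub>k K \<sigma> sqrt l\<^sub>k\<close>, which is about \<open>\<sigma> sqrt (2 / (1 + \<delta>)) sqrt (N\<^sub>k ln (ln N\<^sub>k))\<close>, while by the upper law
  the first \<open>l\<^sub>k\<close> terms only contribute the smaller order \<open>sqrt (l\<^sub>k ln (ln l\<^sub>k))\<close>.\<close>

lemma lil_lower_count:
  fixes X :: "nat \<Rightarrow> 'a \<Rightarrow> real"
  assumes ind: "indep_vars (\<lambda>_. borel) X {1..}" and id: "\<And>i. i \<ge> 1 \<Longrightarrow> distr M borel (X i) = \<mu>"
    and B: "B \<in> sets borel" and q: "\<And>i. i \<ge> 1 \<Longrightarrow> prob {\<omega> \<in> space M. X i \<omega> \<in> B} = q"
    and c: "0 < c" "c < sqrt (2 * (q * (1 - q)))"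
  shows "AE \<omega> in M. \<exists>\<^sub>F n in sequentially. c * sqrt (real n * ln (ln (real n))) \<le> (\<Sum>i=1..n. indicator B (X i \<omega>) - q)"
proof -
  have X: "X i \<in> borel_measurable M" if "i \<ge> 1" for i using ind that by (auto simp: indep_vars_def)
  define Y where "Y i \<omega> = indicator B (X i \<omega>) - q" for i \<omega>
  define \<sigma> where "\<sigma> = sqrt (q * (1 - q))"
  have "sqrt (2 * (q * (1 - q))) > 0" using c by linarith
  then have q01: "q * (1 - q) > 0" unfolding real_sqrt_gt_0_iff by simp
  then have \<sigma>: "\<sigma> > 0" unfolding \<sigma>_def by (subst real_sqrt_gt_0_iff)
  have indY: "indep_vars (\<lambda>_. borel) Y {1..}"
    unfolding Y_def[abs_def] by (rule indep_vars_compose2[OF ind]) (use B in simp)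
  have Ym: "Y i \<in> borel_measurable M" if "i \<ge> 1" for i using indY that by (auto simp: indep_vars_def)
  define \<nu> where "\<nu> = distr \<mu> borel (\<lambda>x. indicator B x - q :: real)"
  have idY: "distr M borel (Y i) = \<nu>" if "i \<ge> 1" for i
    unfolding \<nu>_def id[OF that, symmetric] using B X[OF that]
    by (subst distr_distr) (auto simp: comp_def Y_def[abs_def])
  have Ystat: "expectation (Y i) = 0" "expectation (\<lambda>\<omega>. (Y i \<omega>)\<^sup>2) = \<sigma>\<^sup>2" "integrable M (\<lambda>\<omega>. (Y i \<omega>)\<^sup>2)" if "i \<ge> 1" for i
  proof -
    note ci = centred_indicator[OF X[OF that] B q[OF that]]
    show "expectation (Y i) = 0" "expectation (\<lambda>\<omega>. (Y i \<omega>)\<^sup>2) = \<sigma>\<^sup>2"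
      using ci(1,2) q01 by (simp_all add: Y_def[abs_def] \<sigma>_def)
    show "integrable M (\<lambda>\<omega>. (Y i \<omega>)\<^sup>2)"
    proof -
      have "\<bar>Y i \<omega>\<bar> \<le> 1" for \<omega> using ci(3) by (simp add: Y_def)
      then show ?thesis
        using Ym[OF that] by (intro integrable_const_bound[where B=1]) (auto simp: abs_square_le_1)
    qed
  qed
  have s2: "sqrt (2 * (q * (1 - q))) = \<sigma> * sqrt 2" by (simp add: \<sigma>_def real_sqrt_mult)
  \<comment> \<open>chosen so that \<open>c < \<sigma> sqrt (2 / (1 + \<delta>))\<close>\<close>
  define \<delta> where "\<delta> = (\<sigma> * sqrt 2 / c - 1)"
  have \<delta>: "\<delta> > 0" using c \<sigma> by (simp add: \<delta>_def s2)
  obtain K where K: "K > 0" and tail: "eventually (\<lambda>l. prob {\<omega> \<in> space M. K * \<sigma> * sqrt (real l) \<le> (\<Sum>i=1..l. Y i \<omega>)} \<ge>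
    exp (- ((1 + \<delta>) * K\<^sup>2 / 2))) sequentially"
    using clt_tail_lower_bound[OF indY idY Ystat(1,2,3) \<sigma> \<delta>] by auto
  define \<beta> where "\<beta> = 2 / ((1 + \<delta>) * K\<^sup>2)"
  have \<beta>: "\<beta> > 0" using K \<delta> by (simp add: \<beta>_def)
  have "(1 + \<delta>) * K\<^sup>2 \<noteq> 0" using K \<delta> by simp
  then have \<beta>1: "(1 + \<delta>) * K\<^sup>2 / 2 * \<beta> = 1" by (simp only: \<beta>_def) simp
  have cK: "c * sqrt \<beta> < \<beta> * K * \<sigma>"
  proof -
    have "sqrt \<beta> * K = sqrt (\<beta> * K\<^sup>2)" using K by (simp add: real_sqrt_mult)
    also have "\<beta> * K\<^sup>2 = 2 / (1 + \<delta>)" using K \<delta> by (simp add: \<beta>_def)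
    finally have sK: "sqrt \<beta> * K = sqrt 2 / sqrt (1 + \<delta>)" by (simp add: real_sqrt_divide)
    have "sqrt (1 + \<delta>) < 1 + \<delta>" using \<delta> by (intro real_less_lsqrt) (auto simp: power2_eq_square algebra_simps add_pos_pos)
    moreover have "c * (1 + \<delta>) = \<sigma> * sqrt 2" using c by (simp add: \<delta>_def)
    ultimately have "c * sqrt (1 + \<delta>) < \<sigma> * sqrt 2" using c by (metis mult_strict_left_mono)
    then have "c < \<sigma> * (sqrt \<beta> * K)" unfolding sK using \<delta> by (simp add: field_simps)
    then have "c * sqrt \<beta> < \<sigma> * (sqrt \<beta> * K) * sqrt \<beta>" using \<beta> by (intro mult_strict_right_mono) auto
    also have "\<dots> = \<beta> * K * \<sigma>" using \<beta> by (simp add: algebra_simps)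
    finally show ?thesis .
  qed
  define l where "l k = k ^ k" for k :: nat
  define r where "r k = nat \<lfloor>\<beta> * ln (real k)\<rfloor>" for k :: nat
  define N where "N k = (r k + 1) * l k" for k
  have r: "real (r k) \<le> \<beta> * ln (real k)" "\<beta> * ln (real k) - 1 \<le> real (r k)" if "k \<ge> 1" for k
  proof -
    have "\<beta> * ln (real k) \<ge> 0" using that \<beta> by simp
    then show "real (r k) \<le> \<beta> * ln (real k)" "\<beta> * ln (real k) - 1 \<le> real (r k)"
      unfolding r_def by linarith+
  qed
  have l_top: "filterlim l sequentially sequentially"
  proof -
    have "filterlim (\<lambda>k::nat. real k ^ k) at_top sequentially" by real_asymp
    then have "filterlim (\<lambda>k. real (l k)) at_top sequentially" by (simp add: l_def)
    then show ?thesis by (rule filterlim_sequentially_iff_filterlim_real[THEN iffD2])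
  qed
  have "eventually (\<lambda>k::nat. \<beta> * ln (real k) < real k) sequentially" using \<beta> by real_asymp
  from eventually_conj[OF eventually_gt_at_top[of 0] this]
  obtain k0 where k0: "\<And>k. k \<ge> k0 \<Longrightarrow> 0 < k \<and> \<beta> * ln (real k) < real k"
    unfolding eventually_sequentially by auto
  have Nl: "N k \<le> l k'" if "k \<ge> k0" "k < k'" for k k'
  proof -
    have "r k \<le> k" using r[of k] k0[OF that(1)] by (simp add: order.strict_implies_order)
    then have "N k \<le> (k + 1) * k ^ k" unfolding N_def l_def by (intro mult_right_mono) auto
    also have "\<dots> \<le> (k + 1) * (k + 1) ^ k" by (intro mult_left_mono power_mono) auto
    also have "\<dots> = (k + 1) ^ (k + 1)" by simp
    also have "\<dots> \<le> k' ^ (k + 1)" using that by (intro power_mono) auto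
    also have "\<dots> \<le> k' ^ k'" using that by (intro power_increasing) auto
    finally show ?thesis by (simp add: l_def)
  qed
  define Bl where "Bl k = {l k + 1..N k}" for k
  define S where "S k = {z \<in> space (PiM (Bl k) (\<lambda>_. borel :: real measure)).
    \<forall>j\<in>{1..r k}. K * \<sigma> * sqrt (real (l k)) \<le> (\<Sum>i=j * l k + 1..j * l k + l k. z i)}" for k
  have sub: "{j * l k + 1..j * l k + l k} \<subseteq> Bl k" if "j \<in> {1..r k}" for j k
  proof -
    have "1 * l k \<le> j * l k" "(j + 1) * l k \<le> (r k + 1) * l k" using that by (intro mult_right_mono; simp)+
    then show ?thesis by (auto simp: Bl_def N_def)
  qed
  have "AE \<omega> in M. \<exists>\<^sub>F k in sequentially. restrict (\<lambda>i. Y i \<omega>) (Bl k) \<in> S k"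
  proof (rule second_borel_cantelli)
    have "disjoint_family_on Bl {k0..}"
    proof -
      have "Bl i \<inter> Bl j = {}" if "i < j" "i \<ge> k0" for i j
        using Nl[OF that(2,1)] by (auto simp: Bl_def)
      then show ?thesis unfolding disjoint_family_on_def by (metis Int_commute linorder_neqE_nat atLeast_iff)
    qed
    then show "indep_vars (\<lambda>k. PiM (Bl k) (\<lambda>_. borel)) (\<lambda>k \<omega>. restrict (\<lambda>i. Y i \<omega>) (Bl k)) {k0..}"
      by (rule indep_vars_restrict[OF indY, rotated]) (auto simp: Bl_def)
    show "S k \<in> sets (PiM (Bl k) (\<lambda>_. borel))" for k
    proof -
      have "(\<lambda>z. \<Sum>i=j * l k + 1..j * l k + l k. z i) \<in> borel_measurable (PiM (Bl k) (\<lambda>_. borel :: real measure))"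
        if "j \<in> {1..r k}" for j
        using sub[OF that] by (intro borel_measurable_sum measurable_component_singleton) auto
      then show ?thesis unfolding S_def
        by (intro sets.sets_Collect_finite_All borel_measurable_le) auto
    qed
    show "\<not> summable (\<lambda>k. prob {\<omega> \<in> space M. restrict (\<lambda>i. Y i \<omega>) (Bl k) \<in> S k})"
    proof
      assume sm: "summable (\<lambda>k. prob {\<omega> \<in> space M. restrict (\<lambda>i. Y i \<omega>) (Bl k) \<in> S k})"
      have "eventually (\<lambda>k. real k powr (-1) \<le> prob {\<omega> \<in> space M. restrict (\<lambda>i. Y i \<omega>) (Bl k) \<in> S k}) sequentially"
        using eventually_compose_filterlim[OF tail l_top] eventually_gt_at_top[of 0]
      proof eventually_elim
        case (elim k)
        have "real k powr (-1) = exp (- ((1 + \<delta>) * K\<^sup>2 / 2) * (\<beta> * ln (real k)))"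
        proof -
          have "- ((1 + \<delta>) * K\<^sup>2 / 2) * (\<beta> * ln (real k)) = - ((1 + \<delta>) * K\<^sup>2 / 2 * \<beta>) * ln (real k)"
            by (simp only: mult.assoc mult_minus_left)
          then show ?thesis unfolding \<beta>1 using elim by (simp add: powr_def)
        qed
        also have "\<dots> \<le> exp (- ((1 + \<delta>) * K\<^sup>2 / 2) * real (r k))"
          using r[of k] elim K \<delta> by (simp add: mult_left_mono)
        also have "\<dots> = exp (- ((1 + \<delta>) * K\<^sup>2 / 2)) ^ r k" by (metis exp_of_nat2_mult)
        also have "\<dots> \<le> prob {\<omega> \<in> space M. K * \<sigma> * sqrt (real (l k)) \<le> (\<Sum>i=1..l k. Y i \<omega>)} ^ r k"
          using elim by (intro power_mono) auto
        also have "\<dots> = prob {\<omega> \<in> space M. \<forall>j\<in>{1..r k}. K * \<sigma> * sqrt (real (l k)) \<le> (\<Sum>i=j*l k+1..j*l k+l k. Y i \<omega>)}"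
          by (rule prob_all_blocks_large[OF indY idY, symmetric])
        also have "\<dots> = prob {\<omega> \<in> space M. restrict (\<lambda>i. Y i \<omega>) (Bl k) \<in> S k}"
        proof -
          have "(\<Sum>i=j*l k+1..j*l k+l k. restrict (\<lambda>i. Y i \<omega>) (Bl k) i) = (\<Sum>i=j*l k+1..j*l k+l k. Y i \<omega>)"
            if "j \<in> {1..r k}" for j \<omega> using sub[OF that] by (intro sum.cong) auto
          then show ?thesis unfolding S_def by (intro arg_cong[where f=prob]) (auto simp: space_PiM)
        qed
        finally show ?case .
      qed
      then have "summable (\<lambda>k. real k powr (-1))"
        by (intro summable_comparison_test_ev[OF _ sm]) (auto elim: eventually_mono)
      then show False unfolding summable_real_powr_iff by simp
    qed
  qed
  moreover have "AE \<omega> in M. eventually (\<lambda>n. \<bar>\<Sum>i=1..n. Y i \<omega>\<bar> \<le>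
    (sqrt (2 * (q * (1 - q))) + 1) * sqrt (real n * ln (ln (real n)))) sequentially"
    using lil_upper_count[OF ind B q, of 1] by (simp add: Y_def)
  ultimately show ?thesis
  proof eventually_elim
    case (elim \<omega>)
    define C where "C = sqrt (2 * (q * (1 - q))) + 1"
    have C: "C > 0" unfolding C_def using q01 by (simp add: add_nonneg_pos)
    have N_top: "filterlim N sequentially sequentially"
      using l_top by (rule filterlim_at_top_mono) (auto simp: N_def)
    \<comment> \<open>floor and exact sample size are replaced by bounds for which the limit is an elementary asymptotic expansion\<close>
    have "((\<lambda>k. ((\<beta> * ln (real k) - 1) * (K * \<sigma>) - C * sqrt (ln (ln (real k ^ k)))
        - c * sqrt ((\<beta> * ln (real k) + 1) * ln (ln ((\<beta> * ln (real k) + 1) * real k ^ k)))) / ln (real k))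
        \<longlongrightarrow> \<beta> * (K * \<sigma>) - c * \<beta> powr (1/2)) sequentially"
      using \<beta> K \<sigma> C c by real_asymp
    then have "eventually (\<lambda>k. ((\<beta> * ln (real k) - 1) * (K * \<sigma>) - C * sqrt (ln (ln (real k ^ k)))
        - c * sqrt ((\<beta> * ln (real k) + 1) * ln (ln ((\<beta> * ln (real k) + 1) * real k ^ k)))) / ln (real k) > 0) sequentially"
      by (rule order_tendstoD(1)) (use cK \<beta> in \<open>simp add: powr_half_sqrt mult.assoc\<close>)
    moreover have "eventually (\<lambda>k. real k ^ k > exp 1) sequentially" by real_asymp
    ultimately have "eventually (\<lambda>k. restrict (\<lambda>i. Y i \<omega>) (Bl k) \<in> S k \<longrightarrow>
        c * sqrt (real (N k) * ln (ln (real (N k)))) \<le> (\<Sum>i=1..N k. Y i \<omega>)) sequentially"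
      using eventually_compose_filterlim[OF elim(2) l_top] eventually_gt_at_top[of 1]
    proof eventually_elim
      case (elim k)
      show ?case
      proof
        assume inS: "restrict (\<lambda>i. Y i \<omega>) (Bl k) \<in> S k"
        define L where "L = real k ^ k"
        have lL: "real (l k) = L" by (simp add: l_def L_def)
        define Q where "Q = \<beta> * ln (real k) + 1"
        have Lb: "L > exp 1" using elim by (simp add: L_def)
        have "exp (1::real) > 1" by simp
        with Lb have Lb': "L > 1" by linarith
        have rk: "real (r k) \<le> Q - 1" "Q - 2 \<le> real (r k)" using r[of k] elim by (auto simp: Q_def)
        have "real (N k) = (real (r k) + 1) * L" by (simp add: N_def lL algebra_simps)
        then have NQ: "L \<le> real (N k)" "real (N k) \<le> Q * L"
          using rk Lb' mult_right_mono[of 1 "real (r k) + 1" L] by auto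
        have "ln (exp 1) < ln L" using Lb Lb' by (subst ln_less_cancel_iff) auto
        also have "\<dots> \<le> ln (real (N k))" using NQ Lb' by (subst ln_le_cancel_iff) auto
        finally have lnN: "1 < ln (real (N k))" by simp
        have "ln (real (N k)) \<le> ln (Q * L)" using NQ Lb' by (subst ln_le_cancel_iff) auto
        then have "ln (ln (real (N k))) \<le> ln (ln (Q * L))" using lnN by (subst ln_le_cancel_iff) auto
        then have "real (N k) * ln (ln (real (N k))) \<le> (Q * L) * ln (ln (Q * L))"
          using NQ lnN Lb' by (intro mult_mono) auto
        then have "sqrt (real (N k) * ln (ln (real (N k)))) \<le> sqrt L * sqrt (Q * ln (ln (Q * L)))"
          by (simp flip: real_sqrt_mult add: mult_ac)
        then have "c * sqrt (real (N k) * ln (ln (real (N k)))) \<le> sqrt L * (c * sqrt (Q * ln (ln (Q * L))))"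
          using c by (simp add: mult.left_commute)
        also have "c * sqrt (Q * ln (ln (Q * L))) \<le> (Q - 2) * (K * \<sigma>) - C * sqrt (ln (ln L))"
          using elim by (simp add: zero_less_divide_iff Q_def L_def)
        also have "\<dots> \<le> real (r k) * (K * \<sigma>) - C * sqrt (ln (ln L))"
          using rk K \<sigma> by (intro diff_right_mono mult_right_mono) auto
        also have "sqrt L * (real (r k) * (K * \<sigma>) - C * sqrt (ln (ln L))) = real (r k) * (K * \<sigma> * sqrt L) - C * sqrt (L * ln (ln L))"
          by (simp add: algebra_simps real_sqrt_mult)
        also have "\<dots> \<le> (\<Sum>j=1..r k. \<Sum>i=j*l k+1..j*l k+l k. Y i \<omega>) + (\<Sum>i=1..l k. Y i \<omega>)"
        proof -
          have "K * \<sigma> * sqrt L \<le> (\<Sum>i=j*l k+1..j*l k+l k. Y i \<omega>)" if "j \<in> {1..r k}" for j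
          proof -
            have "(\<Sum>i=j*l k+1..j*l k+l k. restrict (\<lambda>i. Y i \<omega>) (Bl k) i) = (\<Sum>i=j*l k+1..j*l k+l k. Y i \<omega>)"
              using sub[OF that] by (intro sum.cong) auto
            then show ?thesis using inS that unfolding S_def lL by force
          qed
          then have "real (r k) * (K * \<sigma> * sqrt L) \<le> (\<Sum>j=1..r k. \<Sum>i=j*l k+1..j*l k+l k. Y i \<omega>)"
            using sum_mono[of "{1..r k}" "\<lambda>_. K * \<sigma> * sqrt L"] by simp
          moreover have "- (C * sqrt (L * ln (ln L))) \<le> (\<Sum>i=1..l k. Y i \<omega>)"
            using elim unfolding lL C_def by linarith
          ultimately show ?thesis by linarith
        qed
        also have "\<dots> = (\<Sum>i=1..N k. Y i \<omega>)"
          unfolding N_def sum_blocks by simp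
        finally show "c * sqrt (real (N k) * ln (ln (real (N k)))) \<le> (\<Sum>i=1..N k. Y i \<omega>)"
          using Lb' by (simp add: mult_left_mono)
      qed
    qed
    with elim(1) have "\<exists>\<^sub>F k in sequentially. c * sqrt (real (N k) * ln (ln (real (N k)))) \<le> (\<Sum>i=1..N k. Y i \<omega>)"
      by (rule frequently_rev_mp)
    then have "\<exists>\<^sub>F n in sequentially. c * sqrt (real n * ln (ln (real n))) \<le> (\<Sum>i=1..n. Y i \<omega>)"
      unfolding frequently_def using eventually_compose_filterlim[OF _ N_top] by blast
    then show ?case by (simp add: Y_def)
  qed
qed

end

section \<open>Closed forms of the iterated distribution functions\<close>

context real_distribution
begin

lemma interval_measure_cdf: "interval_measure (cdf M) = M"
proof (rule cdf_unique)
  show "real_distribution (interval_measure (cdf M))"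
    by (rule real_distribution_interval_measure)
       (auto intro: cdf_nondecreasing cdf_is_right_cont cdf_lim_at_bot cdf_lim_at_top_prob)
  show "cdf (interval_measure (cdf M)) = cdf M"
    by (rule cdf_interval_measure) (auto intro: cdf_nondecreasing cdf_is_right_cont cdf_lim_at_bot)
  show "real_distribution M" by (rule real_distribution_axioms)
qed

text \<open>Continuity provides a point with distribution function exactly \<open>v\<close> for interior levels only; the levels
  0 and 1 need not be attained.\<close>

lemma cdf_attains:
  assumes cont: "continuous_on UNIV (cdf M)" and "0 < v" "v < 1"
  obtains t where "cdf M t = v"
proof -
  have "eventually (\<lambda>t. cdf M t < v) at_bot" using cdf_lim_at_bot assms by (intro order_tendstoD)
  then obtain a where a: "cdf M a < v" by (auto simp: eventually_at_bot_linorder)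
  have "eventually (\<lambda>t. cdf M t > v) at_top" using cdf_lim_at_top_prob assms by (intro order_tendstoD)
  then obtain b where b: "cdf M b > v" by (auto simp: eventually_at_top_linorder)
  have "a \<le> b" using a b cdf_nondecreasing[of b a] by linarith
  then have "\<exists>t\<ge>a. t \<le> b \<and> cdf M t = v"
    using a b cont by (intro IVT') (auto intro: continuous_on_subset)
  then show ?thesis using that by blast
qed

lemma probability_integral_transform:
  assumes cont: "continuous_on UNIV (cdf M)" and q: "0 \<le> q" "q \<le> 1"
  shows "prob {x. cdf M x \<le> q} = q"
proof -
  have meas: "{x. cdf M x \<le> q} \<in> sets borel"
    using borel_measurable_continuous_onI[OF cont] by measurable
  have "prob {x. cdf M x \<le> q} \<le> q"
  proof (cases "q = 1")
    case False
    show ?thesis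
    proof (rule field_le_epsilon)
      fix e :: real assume "e > 0"
      define v where "v = (if q + e < 1 then q + e else (q + 1) / 2)"
      have v: "q < v" "v < 1" "v \<le> q + e" using \<open>e > 0\<close> False q by (auto simp: v_def field_simps)
      obtain t where t: "cdf M t = v" using cdf_attains[OF cont, of v] v q by auto
      have "{x. cdf M x \<le> q} \<subseteq> {..t}"
      proof
        fix x assume "x \<in> {x. cdf M x \<le> q}"
        then have "cdf M x < cdf M t" using t v by simp
        then show "x \<in> {..t}" using cdf_nondecreasing[of t x] by force
      qed
      then have "prob {x. cdf M x \<le> q} \<le> prob {..t}" by (intro finite_measure_mono) auto
      then show "prob {x. cdf M x \<le> q} \<le> q + e" using t v by (simp add: cdf_def)
    qed
  qed simp
  moreover have "q \<le> prob {x. cdf M x \<le> q}"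
  proof -
    consider "q = 0" | "q = 1" | "0 < q" "q < 1" using q by linarith
    then show ?thesis
    proof cases
      case 2
      then show ?thesis using prob_space cdf_bounded_prob by simp
    next
      case 3
      obtain t where t: "cdf M t = q" using cdf_attains[OF cont 3] .
      have "prob {..t} \<le> prob {x. cdf M x \<le> q}"
        using t meas by (intro finite_measure_mono) (auto intro: cdf_nondecreasing)
      then show ?thesis using t by (simp add: cdf_def)
    qed simp
  qed
  ultimately show ?thesis by simp
qed

text \<open>With a uniform law for \<open>cdf M\<close>, Stieltjes integrals of powers of the distribution function become integrals of monomials.\<close>

lemma distr_cdf_uniform:
  assumes cont: "continuous_on UNIV (cdf M)"
  shows "distr M borel (cdf M) = density lborel (indicator {0..1})"
proof -
  have F[measurable]: "cdf M \<in> borel_measurable borel" by (rule borel_measurable_continuous_onI[OF cont])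
  have rd1: "real_distribution (distr M borel (cdf M))" by simp
  have e: "emeasure (density lborel (indicator {0..1})) B = emeasure lborel ({0..1} \<inter> B)" if "B \<in> sets borel" for B :: "real set"
    using that by (subst emeasure_density) (auto simp: nn_integral_indicator[symmetric] indicator_inter_arith simp del: nn_integral_indicator)
  have rd2: "real_distribution (density lborel (indicator {0..1}))"
    by (intro real_distribution.intro real_distribution_axioms.intro prob_spaceI) (auto simp: e)
  have "cdf (distr M borel (cdf M)) q = cdf (density lborel (indicator {0..1})) q" for q
  proof -
    have L: "cdf (distr M borel (cdf M)) q = prob {x. cdf M x \<le> q}"
      unfolding cdf_def2[of "distr M borel (cdf M)"] by (subst measure_distr) (auto intro!: arg_cong[where f=prob])
    have R: "cdf (density lborel (indicator {0..1})) q = measure lborel ({0..1} \<inter> {..q})"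
      unfolding cdf_def measure_def by (simp add: e)
    consider "q < 0" | "0 \<le> q" "q \<le> 1" | "1 < q" by linarith
    then show ?thesis
    proof cases
      case 1
      then have "{x. cdf M x \<le> q} = {}" "{0..1} \<inter> {..q} = {}" using cdf_nonneg by (auto simp: not_le intro: less_le_trans)
      then show ?thesis unfolding L R by simp
    next
      case 2
      then have "{0..1} \<inter> {..q} = {0..q}" by auto
      then show ?thesis unfolding L R using probability_integral_transform[OF cont 2] 2 by simp
    next
      case 3
      then have "{x. cdf M x \<le> q} = UNIV" "{0..1} \<inter> {..q} = {0..1}"
        using order.trans[OF cdf_bounded_prob less_imp_le[OF 3]] by auto
      then show ?thesis unfolding L R using prob_space by simp
    qed
  qed
  then show ?thesis using rd1 rd2 by (intro cdf_unique) auto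
qed

lemma integral_cdf_power:
  assumes cont: "continuous_on UNIV (cdf M)"
  shows "(LINT s:{..t}|M. cdf M s ^ k) = cdf M t ^ Suc k / real (Suc k)"
proof -
  have F[measurable]: "cdf M \<in> borel_measurable borel" by (rule borel_measurable_continuous_onI[OF cont])
  let ?u = "cdf M t"
  have u: "0 \<le> ?u" "?u \<le> 1" using cdf_nonneg cdf_bounded_prob by auto
  \<comment> \<open>the two sets differ only where the distribution function is flat to the right of \<open>t\<close>, a null set\<close>
  have "AE s in M. s \<in> {..t} \<longleftrightarrow> cdf M s \<le> ?u"
  proof -
    have "prob ({s. cdf M s \<le> ?u} - {..t}) = prob {s. cdf M s \<le> ?u} - prob {..t}"
      by (intro finite_measure_Diff) (auto intro: cdf_nondecreasing)
    also have "\<dots> = 0" using probability_integral_transform[OF cont u] by (simp add: cdf_def)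
    finally have "AE s in M. s \<notin> {s. cdf M s \<le> ?u} - {..t}"
      by (subst prob_eq_0[symmetric]) auto
    then show ?thesis by eventually_elim (auto intro: cdf_nondecreasing)
  qed
  then have "(LINT s:{..t}|M. cdf M s ^ k) = (LINT s|M. (\<lambda>x. indicator {..?u} x * x ^ k) (cdf M s))"
    unfolding set_lebesgue_integral_def
    by (intro integral_cong_AE) (auto simp: indicator_def elim!: eventually_mono)
  also have "\<dots> = (LINT x|distr M borel (cdf M). indicator {..?u} x * x ^ k)"
    by (subst integral_distr) auto
  also have "\<dots> = (LINT x|density lborel (\<lambda>x. ennreal (indicator {0..1} x)). indicator {..?u} x * x ^ k)"
    unfolding distr_cdf_uniform[OF cont] by (simp add: ennreal_indicator)
  also have "\<dots> = (LINT x|lborel. x ^ k * indicator {0..?u} x)"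
    using u by (subst integral_density) (auto intro!: Bochner_Integration.integral_cong simp: indicator_def)
  also have "\<dots> = cdf M t ^ Suc k / real (Suc k)" using u by (subst integral_power) auto
  finally show ?thesis .
qed

lemma iterated_df_cdf:
  assumes cont: "continuous_on UNIV (cdf M)"
  shows "iterated_df (cdf M) p t = cdf M t ^ (p + 1) / fact (p + 1)"
proof (induction p arbitrary: t)
  case (Suc p)
  have "iterated_df (cdf M) (Suc p) t = (LINT s:{..t}|M. cdf M s ^ (p + 1) * (1 / fact (p + 1)))"
    by (simp add: Suc interval_measure_cdf)
  also have "\<dots> = (LINT s:{..t}|M. cdf M s ^ (p + 1)) * (1 / fact (p + 1))"
    by (rule set_integral_mult_left)
  also have "\<dots> = cdf M t ^ (Suc p + 1) / fact (Suc p + 1)"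
    unfolding integral_cdf_power[OF cont] by simp
  finally show ?case .
qed simp

end

text \<open>In the absence of ties, the sample points up to \<open>t\<close> have ranks \<open>1, \<dots>, N t\<close>, each exactly once.\<close>

lemma sum_rank:
  fixes x :: "nat \<Rightarrow> real" and g :: "nat \<Rightarrow> real"
  assumes fin: "finite I" and inj: "inj_on x I"
  defines "N \<equiv> \<lambda>t. card {i \<in> I. x i \<le> t}"
  shows "(\<Sum>i \<in> {i \<in> I. x i \<le> t}. g (N (x i))) = (\<Sum>j=1..N t. g j)"
proof -
  let ?A = "{i \<in> I. x i \<le> t}"
  have fA: "finite ?A" using fin by simp
  have mono: "N a < N b" if "a < b" "b \<in> x ` I" for a b
    unfolding N_def using that fin by (intro psubset_card_mono) force+
  have inj': "inj_on (\<lambda>i. N (x i)) ?A"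
  proof (rule inj_onI)
    fix i j assume ij: "i \<in> ?A" "j \<in> ?A" "N (x i) = N (x j)"
    then have "x i = x j" using mono[of "x i" "x j"] mono[of "x j" "x i"] by (metis (mono_tags, lifting) imageI linorder_neqE_linordered_idom mem_Collect_eq nat_neq_iff)
    then show "i = j" using inj ij by (auto dest: inj_onD)
  qed
  have sub: "(\<lambda>i. N (x i)) ` ?A \<subseteq> {1..N t}"
  proof
    fix m assume "m \<in> (\<lambda>i. N (x i)) ` ?A"
    then obtain i where i: "i \<in> I" "x i \<le> t" "m = N (x i)" by auto
    have "m \<le> N t" unfolding i N_def using i fin by (intro card_mono) auto
    moreover have "0 < m" unfolding i N_def using i fin by (subst card_gt_0_iff) auto
    ultimately show "m \<in> {1..N t}" by auto
  qed
  have "(\<lambda>i. N (x i)) ` ?A = {1..N t}"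
    using sub card_image[OF inj'] by (intro card_subset_eq) (auto simp: N_def)
  then show ?thesis using sum.reindex[OF inj', of g] by simp
qed

lemma empirical_df_card:
  "empirical_df X n \<omega> t = real (card {i \<in> {1..n}. X i \<omega> \<le> t}) / real n"
proof -
  have "(\<Sum>i=1..n. indicator {..t} (X i \<omega>) :: real) = (\<Sum>i\<in>{i \<in> {1..n}. X i \<omega> \<le> t}. 1)"
    unfolding sum.inter_filter[OF finite_atLeastAtMost] by (intro sum.cong) (auto simp: indicator_def)
  then show ?thesis by (simp add: empirical_df_def)
qed

text \<open>The Stieltjes measure of an empirical distribution function is the law of a uniformly chosen sample point.\<close>

lemma integral_empirical_df:
  assumes "n \<ge> 1" and f[measurable]: "f \<in> borel_measurable borel"
  shows "(LINT s:{..t}|interval_measure (empirical_df X n \<omega>). f s) =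
    (\<Sum>i\<in>{i \<in> {1..n}. X i \<omega> \<le> t}. f (X i \<omega>)) / real n"
proof -
  let ?P = "measure_pmf (pmf_of_set {1..n})"
  define \<nu> where "\<nu> = distr ?P borel (\<lambda>i. X i \<omega>)"
  have ne: "{1..n} \<noteq> {}" using assms by simp
  interpret \<nu>: real_distribution \<nu>
    unfolding \<nu>_def by (rule prob_space.real_distribution_distr) (auto intro: measure_pmf.prob_space_axioms)
  have "cdf \<nu> = empirical_df X n \<omega>"
  proof
    fix t
    have "cdf \<nu> t = measure ?P {i. X i \<omega> \<le> t}"
      unfolding cdf_def \<nu>_def by (subst measure_distr) (auto simp: vimage_def)
    also have "\<dots> = empirical_df X n \<omega> t"
      using ne by (subst measure_pmf_of_set) (auto simp: empirical_df_card Int_def intro!: arg_cong[where f=card])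
    finally show "cdf \<nu> t = empirical_df X n \<omega> t" .
  qed
  then have "interval_measure (empirical_df X n \<omega>) = \<nu>" using \<nu>.interval_measure_cdf by simp
  then have "(LINT s:{..t}|interval_measure (empirical_df X n \<omega>). f s) = (LINT s|\<nu>. indicator {..t} s * f s)"
    by (simp add: set_lebesgue_integral_def)
  also have "\<dots> = (LINT i|?P. indicator {..t} (X i \<omega>) * f (X i \<omega>))"
    unfolding \<nu>_def by (subst integral_distr) auto
  also have "\<dots> = (\<Sum>i=1..n. indicator {..t} (X i \<omega>) * f (X i \<omega>)) / real n"
    using ne by (subst integral_pmf_of_set) auto
  also have "(\<Sum>i=1..n. indicator {..t} (X i \<omega>) * f (X i \<omega>)) = (\<Sum>i\<in>{i \<in> {1..n}. X i \<omega> \<le> t}. f (X i \<omega>))"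
    unfolding sum.inter_filter[OF finite_atLeastAtMost] by (intro sum.cong) (auto simp: indicator_def)
  finally show ?thesis .
qed

text \<open>By ranks, each integration is a sum over an initial segment of the integers, so the closed form follows from the hockey stick
  identity for binomial coefficients.\<close>

lemma iterated_df_empirical:
  assumes "n \<ge> 1" and inj: "inj_on (\<lambda>i. X i \<omega>) {1..n}"
  shows "iterated_df (empirical_df X n \<omega>) p t =
    real ((card {i \<in> {1..n}. X i \<omega> \<le> t} + p) choose (p + 1)) / real n ^ (p + 1)"
proof (induction p arbitrary: t)
  case 0
  then show ?case by (simp add: empirical_df_card)
next
  case (Suc p)
  define N where "N t = card {i \<in> {1..n}. X i \<omega> \<le> t}" for t
  have IH: "iterated_df (empirical_df X n \<omega>) p = (\<lambda>t. real ((N t + p) choose (p + 1)) / real n ^ (p + 1))"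
    using Suc by (auto simp: N_def)
  have "mono (\<lambda>t. real ((N t + p) choose (p + 1)) / real n ^ (p + 1))"
  proof (intro monoI divide_right_mono)
    fix s t :: real assume "s \<le> t"
    then have "N s \<le> N t" unfolding N_def by (intro card_mono) auto
    then show "real ((N s + p) choose (p + 1)) \<le> real ((N t + p) choose (p + 1))"
      by (auto intro!: binomial_right_mono)
  qed simp
  then have meas: "(\<lambda>t. real ((N t + p) choose (p + 1)) / real n ^ (p + 1)) \<in> borel_measurable borel"
    by (rule borel_measurable_mono)
  have "iterated_df (empirical_df X n \<omega>) (Suc p) t =
      (\<Sum>i\<in>{i \<in> {1..n}. X i \<omega> \<le> t}. real ((N (X i \<omega>) + p) choose (p + 1)) / real n ^ (p + 1)) / real n"
    unfolding iterated_df.simps IH by (rule integral_empirical_df[OF assms(1) meas])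
  also have "(\<Sum>i\<in>{i \<in> {1..n}. X i \<omega> \<le> t}. real ((N (X i \<omega>) + p) choose (p + 1)) / real n ^ (p + 1)) =
      (\<Sum>j=1..N t. real ((j + p) choose (p + 1)) / real n ^ (p + 1))"
    using sum_rank[OF _ inj, of "\<lambda>j. real ((j + p) choose (p + 1)) / real n ^ (p + 1)" t] by (simp add: N_def)
  also have "\<dots> = real (\<Sum>j=1..N t. (j + p) choose (p + 1)) / real n ^ (p + 1)"
    by (simp add: sum_divide_distrib)
  also have "(\<Sum>j=1..m. (j + p) choose (p + 1)) = (m + Suc p) choose (Suc p + 1)" for m
    by (induction m) auto
  finally show ?case by (simp add: N_def)
qed

lemma fact_mult_binomial_bounds:
  "N ^ (p + 1) \<le> fact (p + 1) * ((N + p) choose (p + 1))"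
  "fact (p + 1) * ((N + p) choose (p + 1)) \<le> (N + p) ^ (p + 1)"
proof -
  show "N ^ (p + 1) \<le> fact (p + 1) * ((N + p) choose (p + 1))"
  proof (induction p)
    case (Suc p)
    have "fact (Suc p + 1) * ((N + Suc p) choose (Suc p + 1)) = fact (p + 1) * (((Suc (N + p)) choose Suc (p + 1)) * Suc (p + 1))"
      by (simp add: algebra_simps)
    also have "\<dots> = (fact (p + 1) * ((N + p) choose (p + 1))) * Suc (N + p)"
      unfolding Suc_times_binomial_eq[symmetric] by (simp only: mult_ac)
    also have "\<dots> \<ge> N ^ (p + 1) * N" using Suc by (intro mult_mono) auto
    finally show ?case by (simp add: mult_ac)
  qed simp
  show "fact (p + 1) * ((N + p) choose (p + 1)) \<le> (N + p) ^ (p + 1)"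
    using binomial_fact_pow[of "N + p" "p + 1"] by (simp add: mult.commute)
qed

section \<open>Linearisation and the extremal constant\<close>

text \<open>First order Taylor expansion of the power function with an explicit quadratic remainder.\<close>

lemma power_diff_linear:
  fixes x y :: real
  assumes "0 \<le> x" "x \<le> 1" "0 \<le> y" "y \<le> 1"
  shows "\<bar>x ^ (p + 1) - y ^ (p + 1) - real (p + 1) * y ^ p * (x - y)\<bar> \<le> (real (p + 1))\<^sup>2 * (x - y)\<^sup>2"
proof (induction p)
  case (Suc p)
  let ?R = "\<lambda>p. x ^ (p + 1) - y ^ (p + 1) - real (p + 1) * y ^ p * (x - y)"
  have "?R (Suc p) = x * ?R p + real (p + 1) * y ^ p * (x - y)\<^sup>2"
    by (simp add: algebra_simps power2_eq_square)
  then have "\<bar>?R (Suc p)\<bar> \<le> \<bar>x * ?R p\<bar> + \<bar>real (p + 1) * y ^ p * (x - y)\<^sup>2\<bar>"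
    by (simp only: abs_triangle_ineq)
  also have "\<bar>x * ?R p\<bar> \<le> 1 * ((real (p + 1))\<^sup>2 * (x - y)\<^sup>2)"
    unfolding abs_mult using assms Suc by (intro mult_mono) auto
  also have "\<bar>real (p + 1) * y ^ p * (x - y)\<^sup>2\<bar> \<le> real (p + 1) * 1 * (x - y)\<^sup>2"
    unfolding abs_mult using assms by (intro mult_mono) (auto simp: power_le_one)
  finally have "\<bar>?R (Suc p)\<bar> \<le> ((real (p + 1))\<^sup>2 + real (p + 1)) * (x - y)\<^sup>2"
    by (simp add: algebra_simps)
  also have "\<dots> \<le> (real (Suc p + 1))\<^sup>2 * (x - y)\<^sup>2"
    by (rule mult_right_mono) (simp add: power2_eq_square algebra_simps, simp)
  finally show ?case .
qed simp

lemma half_powr_square: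
  fixes p :: nat
  shows "((real p + 1/2) powr (real p + 1/2) / (real p + 1) ^ (p + 1))\<^sup>2 =
    ((real p + 1/2) / (real p + 1)) ^ (2 * p + 1) / (real p + 1)"
proof -
  have "((real p + 1/2) powr (real p + 1/2))\<^sup>2 = (real p + 1/2) powr (real (2 * p + 1))"
    by (simp add: power2_eq_square add.commute flip: powr_add)
  also have "\<dots> = (real p + 1/2) ^ (2 * p + 1)" by (rule powr_realpow) simp
  finally have "((real p + 1/2) powr (real p + 1/2))\<^sup>2 = (real p + 1/2) ^ (2 * p + 1)" .
  moreover have "((real p + 1) ^ (p + 1))\<^sup>2 = (real p + 1) ^ (2 * p + 1) * (real p + 1)"
    by (simp only: power_mult[symmetric] power_Suc2[symmetric]) (simp add: mult.commute)
  ultimately show ?thesis by (simp only: power_divide divide_divide_eq_left)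
qed

lemma weighted_sd_square:
  fixes u :: real
  assumes "0 \<le> u" "u \<le> 1"
  shows "(u ^ p * sqrt (2 * (u * (1 - u))))\<^sup>2 = u ^ (2 * p + 1) * (2 * (1 - u))"
  using assms by (simp add: power_mult_distrib power_mult[symmetric] mult_ac)

text \<open>Weighted inequality of arithmetic and geometric means, in the form \<open>y \<le> exp (y - 1)\<close>: with \<open>x\<close> and \<open>z\<close>
  normalised to be 1 at the maximiser \<open>u = (p + 1/2) / (p + 1)\<close>, the exponents \<open>(2 p + 1) (x - 1)\<close> and \<open>z - 1\<close> cancel.\<close>

lemma weighted_sd_le:
  fixes u :: real and p :: nat
  assumes u: "0 \<le> u" "u \<le> 1"
  shows "u ^ p * sqrt (2 * (u * (1 - u))) \<le> (real p + 1/2) powr (real p + 1/2) / (real p + 1) ^ (p + 1)"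
proof (rule power2_le_imp_le)
  define a where "a = real p + 1/2"
  define b where "b = real p + 1"
  have ab: "a > 0" "b > 0" "b = a + 1/2" "real (2 * p + 1) = 2 * a" by (auto simp: a_def b_def)
  define x where "x = u * b / a"
  define z where "z = 2 * b * (1 - u)"
  have xz: "x \<ge> 0" "z \<ge> 0" using u ab by (auto simp: x_def z_def)
  have "x ^ (2 * p + 1) * z \<le> exp (x - 1) ^ (2 * p + 1) * exp (z - 1)"
    using xz exp_ge_add_one_self[of "x - 1"] exp_ge_add_one_self[of "z - 1"] by (intro mult_mono power_mono) auto
  also have "\<dots> = exp (2 * a * (x - 1) + (z - 1))"
    unfolding exp_add ab(4)[symmetric] by (simp only: exp_of_nat_mult)
  also have "2 * a * (x - 1) + (z - 1) = 0"
    using ab(1) unfolding x_def z_def ab(3) by (simp add: field_simps)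
  finally have "x ^ (2 * p + 1) * z \<le> 1" by simp
  then have "(a / b) ^ (2 * p + 1) / b * (x ^ (2 * p + 1) * z) \<le> (a / b) ^ (2 * p + 1) / b * 1"
    using ab by (intro mult_left_mono) auto
  also have "(a / b) ^ (2 * p + 1) / b * (x ^ (2 * p + 1) * z) = (a / b * x) ^ (2 * p + 1) * (z / b)"
    unfolding power_mult_distrib by simp
  also have "a / b * x = u" using ab by (simp add: x_def)
  also have "z / b = 2 * (1 - u)" using ab(2) by (simp add: z_def)
  finally show "(u ^ p * sqrt (2 * (u * (1 - u))))\<^sup>2 \<le> ((real p + 1/2) powr (real p + 1/2) / (real p + 1) ^ (p + 1))\<^sup>2"
    unfolding weighted_sd_square[OF u] half_powr_square by (simp add: a_def b_def)
qed simp

lemma weighted_sd_max: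
  fixes p :: nat
  defines "u \<equiv> (real p + 1/2) / (real p + 1)"
  shows "u ^ p * sqrt (2 * (u * (1 - u))) = (real p + 1/2) powr (real p + 1/2) / (real p + 1) ^ (p + 1)"
proof (rule power2_eq_imp_eq)
  have u: "0 \<le> u" "u \<le> 1" by (auto simp: u_def)
  have "2 * (1 - u) = 1 / (real p + 1)" by (simp add: u_def field_simps)
  then show "(u ^ p * sqrt (2 * (u * (1 - u))))\<^sup>2 = ((real p + 1/2) powr (real p + 1/2) / (real p + 1) ^ (p + 1))\<^sup>2"
    unfolding weighted_sd_square[OF u] half_powr_square by (simp add: u_def)
  show "0 \<le> u ^ p * sqrt (2 * (u * (1 - u)))" using u by simp
qed simp

text \<open>The product \<open>N (N + 1) \<dots> (N + p)\<close> differs from \<open>N\<^sup>p\<^sup>+\<^sup>1\<close> by a lower order term: the iterated empirical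
  function is, up to \<open>O(1 / n)\<close>, the same polynomial in the empirical function as the iterated \<open>F\<close> is in \<open>F\<close>.\<close>

lemma iterated_empirical_approx:
  assumes "N \<le> n" "n \<ge> 1"
  shows "\<bar>real ((N + p) choose (p + 1)) / real n ^ (p + 1) - (real N / real n) ^ (p + 1) / fact (p + 1)\<bar>
    \<le> real (p + 1) ^ (p + 2) / real n"
proof -
  define x y where "x = real (N + p) / real n" and "y = real N / real n"
  have n: "real n \<ge> 1" using assms by simp
  have y: "0 \<le> y" "y \<le> x" "x \<le> real (p + 1)"
    and xy: "x - y = real p / real n" 
  proof -
    show "0 \<le> y" "y \<le> x" by (auto simp: x_def y_def divide_right_mono)
    show "x - y = real p / real n" by (simp add: x_def y_def add_divide_distrib)
    have "real N + real p * 1 \<le> real n + real p * real n" using n assms(1) by (intro add_mono mult_left_mono) auto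
    then show "x \<le> real (p + 1)" using n by (simp add: x_def field_simps)
  qed
  have "real (N ^ (p + 1)) \<le> real (fact (p + 1) * ((N + p) choose (p + 1)))" "real (fact (p + 1) * ((N + p) choose (p + 1))) \<le> real ((N + p) ^ (p + 1))"
    unfolding of_nat_le_iff by (rule fact_mult_binomial_bounds)+
  then have bd: "y ^ (p + 1) \<le> fact (p + 1) * (real ((N + p) choose (p + 1)) / real n ^ (p + 1))"
    "fact (p + 1) * (real ((N + p) choose (p + 1)) / real n ^ (p + 1)) \<le> x ^ (p + 1)"
    unfolding x_def y_def power_divide times_divide_eq_right using n
    by (auto intro!: divide_right_mono simp del: fact_Suc power_Suc)
  have "x ^ (p + 1) - y ^ (p + 1) \<le> real (p + 1) ^ (p + 2) / real n"
  proof -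
    have "x ^ (p + 1) - y ^ (p + 1) = (x - y) * (\<Sum>i<p+1. x ^ i * y ^ (p - i))"
      using power_diff_sumr2[of x "p + 1" y] by (simp add: mult_ac)
    also have "\<dots> \<le> (x - y) * (\<Sum>i<p+1. real (p + 1) ^ p)"
    proof (intro mult_left_mono sum_mono)
      fix i assume "i \<in> {..<p + 1}"
      then have i: "p = i + (p - i)" by simp
      have "x ^ i * y ^ (p - i) \<le> real (p + 1) ^ i * real (p + 1) ^ (p - i)"
        using y by (intro mult_mono power_mono) auto
      also have "\<dots> = real (p + 1) ^ p" using i by (metis power_add)
      finally show "x ^ i * y ^ (p - i) \<le> real (p + 1) ^ p" .
    qed (use y in auto)
    also have "\<dots> = real p * (real (p + 1) * real (p + 1) ^ p) / real n" unfolding xy by simp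
    also have "\<dots> \<le> real (p + 1) * (real (p + 1) * real (p + 1) ^ p) / real n"
      using n by (intro divide_right_mono mult_right_mono) auto
    also have "\<dots> = real (p + 1) ^ (p + 2) / real n" by simp
    finally show ?thesis .
  qed
  with bd have b1: "0 \<le> fact (p + 1) * (real ((N + p) choose (p + 1)) / real n ^ (p + 1)) - y ^ (p + 1)"
    and b2: "fact (p + 1) * (real ((N + p) choose (p + 1)) / real n ^ (p + 1)) - y ^ (p + 1) \<le> real (p + 1) ^ (p + 2) / real n"
    by linarith+
  define D where "D = real ((N + p) choose (p + 1)) / real n ^ (p + 1) - y ^ (p + 1) / fact (p + 1)"
  have D: "fact (p + 1) * D = fact (p + 1) * (real ((N + p) choose (p + 1)) / real n ^ (p + 1)) - y ^ (p + 1)"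
    unfolding D_def right_diff_distrib by (simp del: fact_Suc)
  have f1: "fact (p + 1) \<ge> (1::real)" by (rule fact_ge_1)
  have "0 \<le> D" using b1 f1 unfolding D[symmetric] zero_le_mult_iff by linarith
  moreover have "D \<le> fact (p + 1) * D" using f1 \<open>0 \<le> D\<close> by (simp add: mult_le_cancel_right1 del: fact_Suc)
  ultimately show ?thesis using b2 unfolding D[symmetric] by (simp only: D_def[symmetric] y_def[symmetric] abs_of_nonneg)
qed

section \<open>The law of the iterated logarithm for the integrated empirical process\<close>

context prob_space
begin

text \<open>By Fubini: each vertical section of the diagonal is a single point, which has measure 0.\<close>

lemma AE_indep_neq:
  fixes A B :: "'a \<Rightarrow> real"
  assumes ind: "indep_var borel A borel B" and atom: "\<And>x. emeasure (distr M borel B) {x} = 0"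
  shows "AE \<omega> in M. A \<omega> \<noteq> B \<omega>"
proof -
  have rv[measurable]: "A \<in> borel_measurable M" "B \<in> borel_measurable M"
    using indep_var_rv1[OF ind] indep_var_rv2[OF ind] by auto
  interpret B: prob_space "distr M borel B" by (rule prob_space_distr) simp
  define D where "D = {w \<in> space (borel \<Otimes>\<^sub>M borel :: (real \<times> real) measure). fst w = snd w}"
  have D: "D \<in> sets (borel \<Otimes>\<^sub>M borel)" unfolding D_def by measurable
  have "emeasure M {\<omega> \<in> space M. A \<omega> = B \<omega>} = emeasure (distr M (borel \<Otimes>\<^sub>M borel) (\<lambda>\<omega>. (A \<omega>, B \<omega>))) D"
    using D by (subst emeasure_distr) (auto simp: D_def space_pair_measure intro!: arg_cong[where f="emeasure M"])
  also have "\<dots> = emeasure (distr M borel A \<Otimes>\<^sub>M distr M borel B) D"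
    using ind by (simp add: indep_var_distribution_eq)
  also have "\<dots> = (\<integral>\<^sup>+x. emeasure (distr M borel B) (Pair x -` D) \<partial>distr M borel A)"
    using D by (intro B.emeasure_pair_measure_alt) (simp cong: sets_pair_measure_cong)
  also have "\<dots> = (\<integral>\<^sup>+x. 0 \<partial>distr M borel A)"
  proof (intro nn_integral_cong)
    fix x :: real
    have "Pair x -` D = {x}" by (auto simp: D_def space_pair_measure)
    then show "emeasure (distr M borel B) (Pair x -` D) = 0" using atom by simp
  qed
  finally have "emeasure M {\<omega> \<in> space M. A \<omega> = B \<omega>} = 0" by simp
  then show ?thesis by (intro AE_I[of _ _ "{\<omega> \<in> space M. A \<omega> = B \<omega>}"]) auto
qed

lemma AE_no_ties:
  fixes X :: "nat \<Rightarrow> 'a \<Rightarrow> real"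
  assumes ind: "indep_vars (\<lambda>_. borel) X {1..}" and atom: "\<And>i x. i \<ge> 1 \<Longrightarrow> emeasure (distr M borel (X i)) {x} = 0"
  shows "AE \<omega> in M. inj_on (\<lambda>i. X i \<omega>) {1..}"
proof -
  have "AE \<omega> in M. X i \<omega> \<noteq> X j \<omega>" if "i \<ge> 1" "j \<ge> 1" "i \<noteq> j" for i j
  proof (rule AE_indep_neq)
    have "indep_var borel ((\<lambda>z. z i) \<circ> (\<lambda>\<omega>. restrict (\<lambda>i. X i \<omega>) {i})) borel ((\<lambda>z. z j) \<circ> (\<lambda>\<omega>. restrict (\<lambda>i. X i \<omega>) {j}))"
      using that by (intro indep_var_compose[OF indep_var_restrict[OF ind]]) (auto intro: measurable_component_singleton)
    then show "indep_var borel (X i) borel (X j)" by (simp add: comp_def)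
  qed (rule atom[OF that(2)])
  then have "AE \<omega> in M. \<forall>i\<in>{1..}. \<forall>j\<in>{1..}. i \<noteq> j \<longrightarrow> X i \<omega> \<noteq> X j \<omega>"
    by (subst AE_ball_countable, simp, intro ballI, subst AE_ball_countable, simp, intro ballI)
       (auto intro: AE_impI)
  then show ?thesis by eventually_elim (auto simp: inj_on_def)
qed

end

context real_distribution
begin

text \<open>The linearisation behind the theorem. The process is \<open>F\<^sup>p / p!\<close> times the empirical process, with an error of
  order \<open>(1 + L) / sqrt n\<close> as soon as the latter has the order \<open>sqrt L\<close>; here \<open>L\<close> stands for \<open>ln (ln n)\<close>.\<close>

lemma integrated_empirical_process_approx:
  fixes X :: "nat \<Rightarrow> 'b \<Rightarrow> real"
  assumes cont: "continuous_on UNIV (cdf M)" and "n \<ge> 1" and inj: "inj_on (\<lambda>i. X i \<omega>) {1..}"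
  defines "c \<equiv> \<lambda>t. (\<Sum>i=1..n. indicator {..t} (X i \<omega>))"
  assumes d: "\<bar>c t - real n * cdf M t\<bar> \<le> 2 * sqrt (real n * L)" and L: "L \<ge> 0"
  shows "\<bar>integrated_empirical_process X (cdf M) p n \<omega> t - cdf M t ^ p / fact p * ((c t - real n * cdf M t) / sqrt (real n))\<bar>
    \<le> real (p + 1) ^ (p + 2) * (1 + 4 * L) / sqrt (real n)"
proof -
  define N where "N = card {i \<in> {1..n}. X i \<omega> \<le> t}"
  define x y K where "x = real N / real n" and "y = cdf M t" and "K = real (p + 1) ^ (p + 2)"
  have n: "real n > 0" using assms by simp
  have cN: "c t = real N" using empirical_df_card[of X n \<omega> t] n by (simp add: empirical_df_def c_def N_def)
  have "N \<le> card {1..n}" unfolding N_def by (intro card_mono) auto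
  then have Nn: "N \<le> n" by simp
  have xy: "0 \<le> x" "x \<le> 1" "0 \<le> y" "y \<le> 1"
    using Nn n cdf_nonneg cdf_bounded_prob by (auto simp: x_def y_def)
  have cxy: "c t - real n * cdf M t = real n * (x - y)" using n by (simp add: cN x_def y_def algebra_simps)
  define I where "I = real ((N + p) choose (p + 1)) / real n ^ (p + 1)"
  have "inj_on (\<lambda>i. X i \<omega>) {1..n}" by (rule inj_on_subset[OF inj]) auto
  then have proc: "integrated_empirical_process X (cdf M) p n \<omega> t = sqrt (real n) * (I - y ^ (p + 1) / fact (p + 1))"
    unfolding integrated_empirical_process_def I_def N_def y_def
    using iterated_df_empirical[of n X \<omega> p t] iterated_df_cdf[OF cont, of p t] assms by simp
  have f1: "fact (p + 1) \<ge> (1::real)" by (rule fact_ge_1)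
  have pf: "y ^ p / fact p * (x - y) = real (p + 1) * y ^ p * (x - y) / fact (p + 1)" by simp
  have "\<bar>I - x ^ (p + 1) / fact (p + 1)\<bar> \<le> K / real n"
    unfolding I_def x_def K_def using Nn assms by (intro iterated_empirical_approx) auto
  moreover have "\<bar>x ^ (p + 1) / fact (p + 1) - y ^ (p + 1) / fact (p + 1) - y ^ p / fact p * (x - y)\<bar> \<le> K * (x - y)\<^sup>2"
  proof -
    have "\<bar>x ^ (p + 1) / fact (p + 1) - y ^ (p + 1) / fact (p + 1) - y ^ p / fact p * (x - y)\<bar> =
      \<bar>x ^ (p + 1) - y ^ (p + 1) - real (p + 1) * y ^ p * (x - y)\<bar> / fact (p + 1)"
      unfolding pf diff_divide_distrib[symmetric] abs_divide abs_of_nonneg[OF fact_ge_zero] ..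
    also have "\<dots> \<le> (real (p + 1))\<^sup>2 * (x - y)\<^sup>2 / 1"
      using f1 by (intro frac_le power_diff_linear xy) auto
    also have "\<dots> \<le> K * (x - y)\<^sup>2"
      unfolding K_def by (auto intro!: mult_right_mono power_increasing simp del: power_Suc)
    finally show ?thesis .
  qed
  ultimately have step: "\<bar>(I - y ^ (p + 1) / fact (p + 1)) - y ^ p / fact p * (x - y)\<bar> \<le> K / real n + K * (x - y)\<^sup>2"
    by linarith
  have sq: "(x - y)\<^sup>2 \<le> 4 * L / real n"
  proof -
    have "\<bar>real n * (x - y)\<bar>\<^sup>2 \<le> (2 * sqrt (real n * L))\<^sup>2" using d unfolding cxy by (intro power_mono) auto
    then have "real n * (real n * (x - y)\<^sup>2) \<le> real n * (4 * L)"
      using n L by (simp add: power_mult_distrib power2_eq_square mult_ac)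
    then have "real n * (x - y)\<^sup>2 \<le> 4 * L" using n by (simp add: mult_le_cancel_left)
    then show ?thesis using n by (simp add: field_simps)
  qed
  note step
  also have "K / real n + K * (x - y)\<^sup>2 \<le> K / real n + K * (4 * L / real n)"
    by (intro add_left_mono mult_left_mono sq) (simp add: K_def)
  also have "K / real n + K * (4 * L / real n) = K * (1 + 4 * L) / real n" by (simp add: distrib_left add_divide_distrib)
  finally have "\<bar>(I - y ^ (p + 1) / fact (p + 1)) - y ^ p / fact p * (x - y)\<bar> \<le> K * (1 + 4 * L) / real n" .
  then have "sqrt (real n) * \<bar>(I - y ^ (p + 1) / fact (p + 1)) - y ^ p / fact p * (x - y)\<bar> \<le> sqrt (real n) * (K * (1 + 4 * L) / real n)"
    by (intro mult_left_mono) auto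
  also have "sqrt (real n) * (K * (1 + 4 * L) / real n) = K * (1 + 4 * L) / sqrt (real n)"
    using n by (simp add: field_simps)
  also have "sqrt (real n) * \<bar>(I - y ^ (p + 1) / fact (p + 1)) - y ^ p / fact p * (x - y)\<bar> =
    \<bar>integrated_empirical_process X (cdf M) p n \<omega> t - cdf M t ^ p / fact p * ((c t - real n * cdf M t) / sqrt (real n))\<bar>"
  proof -
    have 1: "real n * (x - y) / sqrt (real n) = sqrt (real n) * (x - y)" using n by (simp add: field_simps)
    have 2: "s * a - b * (s * d) = s * (a - b * d)" for s a b d :: real by (simp add: algebra_simps)
    show ?thesis
      unfolding proc cxy 1 unfolding y_def[symmetric] 2 by (simp add: abs_mult)
  qed
  finally show ?thesis unfolding K_def .
qed

end

lemma Limsup_eqI_approx: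
  fixes f :: "nat \<Rightarrow> ereal"
  assumes up: "\<And>k::nat. eventually (\<lambda>n. f n \<le> ereal (c + 1 / real (Suc k))) sequentially"
    and low: "\<And>k::nat. \<exists>\<^sub>F n in sequentially. ereal (c - 1 / real (Suc k)) \<le> f n"
  shows "limsup f = ereal c"
proof (rule antisym)
  show "limsup f \<le> ereal c"
  proof (rule ereal_le_epsilon2)
    fix e :: real assume "0 < e"
    then obtain k where k: "1 / real (Suc k) < e" using nat_approx_posE by blast
    have "limsup f \<le> ereal (c + 1 / real (Suc k))" by (rule Limsup_bounded[OF up])
    also have "\<dots> \<le> ereal c + ereal e" using k by simp
    finally show "limsup f \<le> ereal c + ereal e" .
  qed
  have "ereal (c - 1 / real (Suc k)) \<le> limsup f" for k
  proof (rule ccontr)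
    assume "\<not> ereal (c - 1 / real (Suc k)) \<le> limsup f"
    then have "eventually (\<lambda>n. f n < ereal (c - 1 / real (Suc k))) sequentially"
      using Limsup_le_iff[of sequentially f "limsup f"] by (simp add: not_le)
    with low[of k] show False by (auto simp: frequently_def not_le)
  qed
  then have "ereal c \<le> limsup f + ereal e" if "0 < e" for e
  proof -
    obtain k where k: "1 / real (Suc k) < e" using \<open>0 < e\<close> nat_approx_posE by blast
    have "ereal c = ereal (c - 1 / real (Suc k)) + ereal (1 / real (Suc k))" by simp
    also have "\<dots> \<le> limsup f + ereal e" using k \<open>\<And>k. ereal (c - 1 / real (Suc k)) \<le> limsup f\<close> by (intro add_mono) auto
    finally show ?thesis .
  qed
  then show "ereal c \<le> limsup f" by (rule ereal_le_epsilon2)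
qed

theorem corollary2p7:
  fixes M :: "'a measure" and X :: "nat \<Rightarrow> 'a \<Rightarrow> real" and F :: "real \<Rightarrow> real" and p :: nat
  assumes "prob_space M"
    and "prob_space.indep_vars M (\<lambda>_. borel) X {1..}"
    and "\<And>i. i \<ge> 1 \<Longrightarrow> cdf (distr M borel (X i)) = F"
    and "continuous_on UNIV F"
    and "p \<ge> 1"
  shows "AE \<omega> in M.
    limsup (\<lambda>n. (SUP t. ereal \<bar>integrated_empirical_process X F p n \<omega> t\<bar>)
                 / ereal (sqrt (ln (ln (real n)))))
    = ereal ((real p + 1/2) powr (real p + 1/2) / (fact p * (real p + 1) ^ (p + 1)))"
proof -
  interpret prob_space M by fact
  note ind = assms(2)
  define \<mu> where "\<mu> = distr M borel (X 1)"
  have X: "X i \<in> borel_measurable M" if "i \<ge> 1" for i using ind that by (auto simp: indep_vars_def)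
  interpret \<mu>: real_distribution \<mu> unfolding \<mu>_def using X by simp
  have F: "F = cdf \<mu>" using assms(3)[of 1] by (simp add: \<mu>_def)
  note cont = assms(4)[unfolded F]
  have id: "distr M borel (X i) = \<mu>" if "i \<ge> 1" for i
    using that X assms(3)[OF that] F \<mu>.real_distribution_axioms by (intro cdf_unique) auto
  have probX: "prob {\<omega> \<in> space M. X i \<omega> \<in> B} = measure \<mu> B" if "i \<ge> 1" "B \<in> sets borel" for i B
    using that X unfolding id[OF that(1), symmetric]
    by (subst measure_distr) (auto intro!: arg_cong[where f=prob])
  have Fm[measurable]: "F \<in> borel_measurable borel" unfolding F by (rule borel_measurable_continuous_onI[OF cont])
  have F01: "0 \<le> F t" "F t \<le> 1" for t unfolding F by (auto simp: \<mu>.cdf_nonneg \<mu>.cdf_bounded_prob)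
  have Fmono: "s \<le> t \<Longrightarrow> F s \<le> F t" for s t unfolding F by (rule \<mu>.cdf_nondecreasing)
  interpret U: uniform_sample M "\<lambda>i \<omega>. F (X i \<omega>)"
  proof
    show "indep_vars (\<lambda>_. borel) (\<lambda>i \<omega>. F (X i \<omega>)) {1..}"
      by (rule indep_vars_compose2[OF ind]) simp
    have "{x. F x \<le> q} \<in> sets borel" for q :: real by measurable
    moreover fix i :: nat and q :: real assume "1 \<le> i" "0 \<le> q" "q \<le> 1"
    ultimately show "prob {\<omega> \<in> space M. F (X i \<omega>) \<le> q} = q"
      using probX[of i "{x. F x \<le> q}"] \<mu>.probability_integral_transform[OF cont] by (simp add: F)
  qed
  have noties: "AE \<omega> in M. inj_on (\<lambda>i. X i \<omega>) {1..}"
  proof (rule AE_no_ties[OF ind])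
    fix i :: nat and x :: real assume "i \<ge> 1"
    have "isCont (cdf \<mu>) x" using cont by (simp add: continuous_on_eq_continuous_at)
    then show "emeasure (distr M borel (X i)) {x} = 0"
      unfolding id[OF \<open>i \<ge> 1\<close>] by (simp add: \<mu>.isCont_cdf \<mu>.emeasure_eq_measure)
  qed
  define u where "u = (real p + 1/2) / (real p + 1)"
  have u: "0 < u" "u < 1" by (auto simp: u_def)
  then obtain t0 where t0: "F t0 = u" using \<mu>.cdf_attains[OF cont u] unfolding F by blast
  define s0 where "s0 = sqrt (2 * (u * (1 - u)))"
  have s0: "s0 > 0" using u by (simp add: s0_def)
  define \<kappa> where "\<kappa> = (real p + 1/2) powr (real p + 1/2) / (real p + 1) ^ (p + 1)"
  have \<kappa>u: "u ^ p * s0 = \<kappa>" unfolding u_def s0_def \<kappa>_def by (rule weighted_sd_max)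
  \<comment> \<open>tolerances for a countable family of almost sure statements, small enough that \<open>s0 - e k\<close> is a positive constant below the sharp one\<close>
  define e where "e k = min (1/2) (s0 / 2) / real (Suc k)" for k
  have e: "0 < e k" "e k \<le> 1" "e k < s0" "e k \<le> 1 / 2 / real (Suc k)" for k
  proof -
    have "min (1/2) (s0/2) > 0" using s0 by simp
    then have "e k \<le> min (1/2) (s0/2) / 1" unfolding e_def by (intro frac_le) auto
    then show "e k \<le> 1" "e k < s0" using s0 by auto
    show "0 < e k" using s0 by (simp add: e_def)
    show "e k \<le> 1 / 2 / real (Suc k)" unfolding e_def by (intro divide_right_mono) auto
  qed
  define c where "c n \<omega> t = (\<Sum>i=1..n. indicator {..t} (X i \<omega>) :: real)" for n \<omega> t
  define L where "L n = ln (ln (real n))" for n :: nat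
  define K where "K = real (p + 1) ^ (p + 2)"
  define R where "R n = K * (1 + 4 * L n) / sqrt (real n)" for n
  have upper: "AE \<omega> in M. \<forall>k. eventually (\<lambda>n. \<forall>t. \<bar>c n \<omega> t - real n * F t\<bar> \<le> (sqrt (2 * (F t * (1 - F t))) + e k) * sqrt (real n * L n)) sequentially"
  proof (subst AE_all_countable, intro allI)
    fix k
    show "AE \<omega> in M. eventually (\<lambda>n. \<forall>t. \<bar>c n \<omega> t - real n * F t\<bar> \<le> (sqrt (2 * (F t * (1 - F t))) + e k) * sqrt (real n * L n)) sequentially"
      using U.lil_upper_uniform[OF e(1)[of k]]
    proof eventually_elim
      case (elim \<omega>)
      then show ?case
      proof eventually_elim
        case (elim n)
        show ?case
        proof
          fix t
          have "(\<Sum>i=1..n. indicator {..<F t} (F (X i \<omega>))) \<le> c n \<omega> t"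
          proof -
            have "F x < F t \<Longrightarrow> x \<le> t" for x using Fmono[of t x] by force
            then show ?thesis unfolding c_def by (intro sum_mono) (auto simp: indicator_def)
          qed
          moreover have "c n \<omega> t \<le> (\<Sum>i=1..n. indicator {..F t} (F (X i \<omega>)))"
            unfolding c_def using Fmono by (intro sum_mono) (auto simp: indicator_def)
          ultimately show "\<bar>c n \<omega> t - real n * F t\<bar> \<le> (sqrt (2 * (F t * (1 - F t))) + e k) * sqrt (real n * L n)"
            unfolding L_def using elim F01 by blast
        qed
      qed
    qed
  qed
  have lower: "AE \<omega> in M. \<forall>k. \<exists>\<^sub>F n in sequentially. (s0 - e k) * sqrt (real n * L n) \<le> c n \<omega> t0 - real n * u"
  proof (subst AE_all_countable, intro allI)
    fix k
    have "prob {\<omega> \<in> space M. X i \<omega> \<in> {..t0}} = u" if "i \<ge> 1" for i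
      using probX[OF that, of "{..t0}"] t0 by (simp add: F cdf_def)
    from lil_lower_count[OF ind id _ this, of "s0 - e k"] e[of k]
    show "AE \<omega> in M. \<exists>\<^sub>F n in sequentially. (s0 - e k) * sqrt (real n * L n) \<le> c n \<omega> t0 - real n * u"
      by (simp add: s0_def L_def c_def sum_subtractf)
  qed
  have small: "eventually (\<lambda>n. R n \<le> e k * sqrt (L n)) sequentially" for k
    unfolding R_def L_def using e(1)[of k] by real_asymp
  have Lpos: "eventually (\<lambda>n. L n > 0) sequentially" unfolding L_def by real_asymp
  have fact1: "fact p \<ge> (1::real)" by (rule fact_ge_1)
  show ?thesis
    using noties upper lower
  proof eventually_elim
    case (elim \<omega>)
    let ?\<alpha> = "integrated_empirical_process X F p"
    \<comment> \<open>the crude consequence \<open>2 sqrt (n L)\<close> of the uniform upper law suffices to control the quadratic error\<close>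
    have approx: "eventually (\<lambda>n. \<forall>t. \<bar>?\<alpha> n \<omega> t - F t ^ p / fact p * ((c n \<omega> t - real n * F t) / sqrt (real n))\<bar> \<le> R n) sequentially"
      using elim(2)[rule_format, of 0] Lpos eventually_gt_at_top[of 0]
    proof eventually_elim
      case (elim n)
      show ?case
      proof
        fix t
        have "F t * (1 - F t) \<le> 1/4" using zero_le_power2[of "F t - 1/2"] by (simp add: power2_eq_square algebra_simps)
        then have "sqrt (2 * (F t * (1 - F t))) \<le> 1" by simp
        then have "sqrt (2 * (F t * (1 - F t))) + e 0 \<le> 2" using e(2)[of 0] by linarith
        then have "(sqrt (2 * (F t * (1 - F t))) + e 0) * sqrt (real n * L n) \<le> 2 * sqrt (real n * L n)"
          using elim by (intro mult_right_mono) auto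
        with elim(1) have "\<bar>c n \<omega> t - real n * F t\<bar> \<le> 2 * sqrt (real n * L n)" by (meson order.trans)
        then show "\<bar>?\<alpha> n \<omega> t - F t ^ p / fact p * ((c n \<omega> t - real n * F t) / sqrt (real n))\<bar> \<le> R n"
          unfolding R_def K_def c_def F using \<open>inj_on (\<lambda>i. X i \<omega>) {1..}\<close> elim
          by (intro \<mu>.integrated_empirical_process_approx cont) auto
      qed
    qed
    show ?case
    proof (rule Limsup_eqI_approx)
      fix k
      have \<kappa>p: "(real p + 1/2) powr (real p + 1/2) / (fact p * (real p + 1) ^ (p + 1)) = \<kappa> / fact p"
        by (simp add: \<kappa>_def)
      have "e k / fact p \<le> e k" using e(1)[of k] fact1 by (simp add: divide_le_eq mult_le_cancel_left1)
      moreover have "1 / real (Suc k) = 2 * (1 / 2 / real (Suc k))" by (simp add: field_simps)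
      ultimately have ek: "e k / fact p + e k \<le> 1 / real (Suc k)" using e(4)[of k] by linarith
      show "eventually (\<lambda>n. (SUP t. ereal \<bar>?\<alpha> n \<omega> t\<bar>) / ereal (sqrt (ln (ln (real n)))) \<le>
        ereal ((real p + 1/2) powr (real p + 1/2) / (fact p * (real p + 1) ^ (p + 1)) + 1 / real (Suc k))) sequentially"
        using approx small[of k] Lpos elim(2)[rule_format, of k] eventually_gt_at_top[of 0]
      proof eventually_elim
        case (elim n)
        have sL: "sqrt (L n) > 0" using elim by simp
        have "\<bar>?\<alpha> n \<omega> t\<bar> \<le> (\<kappa> / fact p + 1 / real (Suc k)) * sqrt (L n)" for t
        proof -
          have "\<bar>F t ^ p / fact p * ((c n \<omega> t - real n * F t) / sqrt (real n))\<bar> = F t ^ p / fact p * (\<bar>c n \<omega> t - real n * F t\<bar> / sqrt (real n))"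
            using F01[of t] by (simp add: abs_mult)
          also have "\<dots> \<le> F t ^ p / fact p * (((sqrt (2 * (F t * (1 - F t))) + e k) * sqrt (real n * L n)) / sqrt (real n))"
            using elim F01[of t] by (intro mult_left_mono divide_right_mono) auto
          also have "\<dots> = (F t ^ p * sqrt (2 * (F t * (1 - F t))) + F t ^ p * e k) / fact p * sqrt (L n)"
            using elim by (simp add: real_sqrt_mult field_simps)
          also have "\<dots> \<le> (\<kappa> + 1 * e k) / fact p * sqrt (L n)"
            unfolding \<kappa>_def using sL e(1)[of k] F01[of t]
            by (intro mult_right_mono divide_right_mono add_mono weighted_sd_le) (auto simp: power_le_one)
          finally have "\<bar>?\<alpha> n \<omega> t\<bar> \<le> (\<kappa> + 1 * e k) / fact p * sqrt (L n) + e k * sqrt (L n)"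
            using elim(1)[rule_format, of t] elim(2) by linarith
          also have "\<dots> = (\<kappa> / fact p + (e k / fact p + e k)) * sqrt (L n)" by (simp add: algebra_simps add_divide_distrib)
          also have "\<dots> \<le> (\<kappa> / fact p + 1 / real (Suc k)) * sqrt (L n)"
            using sL ek by (intro mult_right_mono add_left_mono) auto
          finally show ?thesis .
        qed
        then have "(SUP t. ereal \<bar>?\<alpha> n \<omega> t\<bar>) \<le> ereal ((\<kappa> / fact p + 1 / real (Suc k)) * sqrt (L n))"
          by (intro SUP_least) simp
        then show ?case unfolding \<kappa>p L_def[symmetric] using sL
          by (subst ereal_divide_le_pos) (auto simp: mult_ac)
      qed
      have "\<exists>\<^sub>F n in sequentially. (s0 - e k) * sqrt (real n * L n) \<le> c n \<omega> t0 - real n * u"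
        using elim(3) by blast
      then show "\<exists>\<^sub>F n in sequentially. ereal ((real p + 1/2) powr (real p + 1/2) / (fact p * (real p + 1) ^ (p + 1)) - 1 / real (Suc k))
        \<le> (SUP t. ereal \<bar>?\<alpha> n \<omega> t\<bar>) / ereal (sqrt (ln (ln (real n))))"
      proof (rule frequently_rev_mp)
        show "eventually (\<lambda>n. (s0 - e k) * sqrt (real n * L n) \<le> c n \<omega> t0 - real n * u \<longrightarrow>
          ereal ((real p + 1/2) powr (real p + 1/2) / (fact p * (real p + 1) ^ (p + 1)) - 1 / real (Suc k))
          \<le> (SUP t. ereal \<bar>?\<alpha> n \<omega> t\<bar>) / ereal (sqrt (ln (ln (real n))))) sequentially"
          using approx small[of k] Lpos eventually_gt_at_top[of 0]
        proof (eventually_elim, intro impI)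
          fix n :: nat
          assume a: "\<forall>t. \<bar>?\<alpha> n \<omega> t - F t ^ p / fact p * ((c n \<omega> t - real n * F t) / sqrt (real n))\<bar> \<le> R n"
            "R n \<le> e k * sqrt (L n)" "L n > 0" "n > 0" "(s0 - e k) * sqrt (real n * L n) \<le> c n \<omega> t0 - real n * u"
          have sL: "sqrt (L n) > 0" using a by simp
          have "(\<kappa> / fact p - 1 / real (Suc k)) * sqrt (L n) \<le> (\<kappa> / fact p - (e k / fact p + e k)) * sqrt (L n)"
            using sL ek by (intro mult_right_mono diff_left_mono) auto
          also have "\<dots> = (\<kappa> - 1 * e k) / fact p * sqrt (L n) - e k * sqrt (L n)" by (simp add: algebra_simps diff_divide_distrib)
          also have "(\<kappa> - 1 * e k) / fact p * sqrt (L n) \<le> (u ^ p * s0 - u ^ p * e k) / fact p * sqrt (L n)"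
            unfolding \<kappa>u[symmetric] using sL e(1)[of k] u
            by (intro mult_right_mono divide_right_mono diff_left_mono) (auto simp: power_le_one)
          also have "\<dots> = u ^ p / fact p * (((s0 - e k) * sqrt (real n * L n)) / sqrt (real n))"
            using a by (simp add: real_sqrt_mult field_simps)
          also have "\<dots> \<le> u ^ p / fact p * ((c n \<omega> t0 - real n * u) / sqrt (real n))"
            using a u by (intro mult_left_mono divide_right_mono) auto
          finally have "(\<kappa> / fact p - 1 / real (Suc k)) * sqrt (L n) \<le> \<bar>?\<alpha> n \<omega> t0\<bar>"
            using a(1)[rule_format, of t0] a(2) unfolding t0 by linarith
          also have "ereal \<bar>?\<alpha> n \<omega> t0\<bar> \<le> (SUP t. ereal \<bar>?\<alpha> n \<omega> t\<bar>)" by (rule SUP_upper) simp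
          finally have "ereal ((\<kappa> / fact p - 1 / real (Suc k)) * sqrt (L n)) \<le> (SUP t. ereal \<bar>?\<alpha> n \<omega> t\<bar>)" by simp
          then show "ereal ((real p + 1/2) powr (real p + 1/2) / (fact p * (real p + 1) ^ (p + 1)) - 1 / real (Suc k))
            \<le> (SUP t. ereal \<bar>?\<alpha> n \<omega> t\<bar>) / ereal (sqrt (ln (ln (real n))))"
            unfolding \<kappa>p L_def[symmetric] using sL by (subst ereal_le_divide_pos) (auto simp: mult_ac)
        qed
      qed
    qed
  qed
qed

end
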